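(* Let $\{\xi_k\}_{k\ge 0}$ and $\{\eta_k\}_{k\ge 0}$ be bounded, strictly increasing sequences of positive numbers such that the unilateral weighted shifts $W_\xi$ and $W_\eta$ are subnormal, with Berger measures $\nu$ and $\omega$ respectively. Let $0<a<1$ and $0<b<1$ satisfy $a\eta_0=b\xi_0$, and let $\mathbf{T}\equiv(T_1,T_2)$ be the $2$-variable weighted shift on $\ell^2(\mathbb{Z}_+^2)$ with weights $$\alpha_{(k_1,k_2)}=\begin{cases}\xi_{k_1}&\text{if }k_1\ge1\text{ or }k_2\ge1,\\ a&\text{if }k_1=k_2=0,\end{cases}\qquad \beta_{(k_1,k_2)}=\begin{cases}\eta_{k_2}&\text{if }k_1\ge1\text{ or }k_2\ge1,\\ b&\text{if }k_1=k_2=0.\end{cases}$$ Let $\nu_{\mathcal M}$ and $\omega_{\mathcal M}$ be the Berger measures of $\mathrm{shift}(\xi_1,\xi_2,\ldots)$ and $\mathrm{shift}(\eta_1,\eta_2,\ldots)$, let $\eta_e:=\eta_{ext}(\omega_{\mathcal M})$, and put $$h:=\xi_0\sqrt{\frac{\xi_1^2\eta_1^2-\xi_0^2\eta_0^2}{\xi_0^2\eta_1^2+\xi_1^2\eta_0^2-2\xi_0^2\eta_0^2}},\qquad s:=\sqrt{\frac{\xi_0^2\xi_1^2\eta_1^2}{\xi_1^2\eta_0^2+\xi_0^2\eta_1^2-\xi_0^2\eta_0^2}},\qquad s_2:=\frac{\xi_0}{\eta_0}\eta_e,$$ $$u:=\frac{\xi_0^2\eta_e^2\eta_1^2}{\xi_1^2(\eta_1^2-\eta_e^2)+\xi_0^2\eta_e^2},$$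 $$v:=\frac{\xi_1^2(\eta_1^2-\eta_e^2)+2\xi_0^2\eta_e^2-\sqrt{(\eta_1^2-\eta_e^2)\big(\xi_1^4(\eta_1^2-\eta_e^2)+4\xi_0^2\eta_e^2(\xi_1^2-\xi_0^2)\big)}}{2\xi_0^2}.$$ Assume that $s_2=\xi_{ext}(\nu_{\mathcal M})$, that $\eta_0\le\min\{u,v\}$, and that $s<a\le h$. Then: (i) $T_1T_2=T_2T_1$; (ii) $T_1$ is subnormal; (iii) $T_2$ is subnormal; (iv) $\mathbf{T}$ is hyponormal; and (v) $\mathbf{T}$ is not subnormal.
   Context: A pair $\mathbf{T}=(T_1,T_2)$ of bounded operators on a Hilbert space $\mathcal H$ is (jointly) hyponormal if the operator matrix $\begin{pmatrix}[T_1^*,T_1]&[T_2^*,T_1]\\ [T_1^*,T_2]&[T_2^*,T_2]\end{pmatrix}$ is positive on $\mathcal H\oplus\mathcal H$, where $[S,T]=ST-TS$. It is normal if $T_1,T_2$ commute and each is normal, and subnormal if it is the restriction of a normal pair to a common invariant subspace. A single operator is subnormal if it is the restriction of a normal operator to an invariant subspace. For a bounded sequence of positive numbers $\alpha=\{\alpha_n\}_{n\ge0}$, $W_\alpha=\mathrm{shift}(\alpha_0,\alpha_1,\ldots)$ is the unilateral weighted shift on $\ell^2(\mathbb{Z}_+)$, $W_\alpha e_n=\alpha_ne_{n+1}$. It is subnormal iff there is a probability measure $\xi$ on $[0,\|W_\alpha\|^2]$ (its Berger measure) with $\alpha_0^2\cdots\alpha_{k-1}^2=\int t^k\,d\xi(t)$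 for all $k\ge1$. Given a subnormal weighted shift with weights $\eta_1\le\eta_2\le\cdots$ and Berger measure $\sigma$, the extremal value is $\eta_{ext}(\sigma):=\left(\int\frac1t\,d\sigma(t)\right)^{-1/2}$ if $\frac1t\in L^1(\sigma)$, and $\eta_{ext}(\sigma):=0$ otherwise (and similarly $\xi_{ext}$). The $2$-variable weighted shift with bounded positive weights $\alpha_{\mathbf k},\beta_{\mathbf k}$ ($\mathbf k\in\mathbb{Z}_+^2$) is the pair on $\ell^2(\mathbb{Z}_+^2)$ given by $T_1e_{\mathbf k}=\alpha_{\mathbf k}e_{\mathbf k+(1,0)}$, $T_2e_{\mathbf k}=\beta_{\mathbf k}e_{\mathbf k+(0,1)}$. *)

theory Defs
  imports "HOL-Probability.Probability"
begin

section \<open>Complex Hilbert spaces\<close>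

text \<open>
  The inner product is linear in its first argument.  Its real part is required to be the inner
  product of \<^class>\<open>real_inner\<close>, so that norm, topology and positive definiteness are
  the library's.
\<close>

class complex_hilbert_space = real_inner + complete_space +
  fixes scaleC :: "complex \<Rightarrow> 'a \<Rightarrow> 'a"  (infixr "*\<^sub>C" 75)
    and cinner :: "'a \<Rightarrow> 'a \<Rightarrow> complex"
  assumes scaleC_add_right: "c *\<^sub>C (x + y) = c *\<^sub>C x + c *\<^sub>C y"
    and scaleC_add_left: "(c + d) *\<^sub>C x = c *\<^sub>C x + d *\<^sub>C x"
    and scaleC_scaleC: "c *\<^sub>C d *\<^sub>C x = (c * d) *\<^sub>C x"
    and scaleC_of_real: "complex_of_real r *\<^sub>C x = r *\<^sub>R x"
    and cinner_commute: "cinner x y = cnj (cinner y x)"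
    and cinner_add_left: "cinner (x + y) z = cinner x z + cinner y z"
    and cinner_scaleC_left: "cinner (c *\<^sub>C x) y = c * cinner x y"
    and Re_cinner: "Re (cinner x y) = inner x y"

instantiation prod :: (complex_hilbert_space, complex_hilbert_space) complex_hilbert_space
begin

definition "scaleC c p = (c *\<^sub>C fst p, c *\<^sub>C snd p)"

definition "cinner p q = cinner (fst p) (fst q) + cinner (snd p) (snd q)"

instance
proof
  fix x y z :: "'a \<times> 'b" and c d :: complex and r :: real
  show "cinner x y = cnj (cinner y x)"
    unfolding cinner_prod_def
    using cinner_commute[of "fst x" "fst y"] cinner_commute[of "snd x" "snd y"] by simp
qed (auto simp: scaleC_prod_def cinner_prod_def scaleC_add_right scaleC_add_left scaleC_scaleC
    scaleC_of_real cinner_add_left cinner_scaleC_left Re_cinner inner_prod_def algebra_simps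
    prod_eq_iff)

end


section \<open>The space of square-summable families\<close>

definition square_summable :: "('i \<Rightarrow> complex) \<Rightarrow> bool" where
  "square_summable f \<longleftrightarrow> (\<lambda>i. (cmod (f i))\<^sup>2) summable_on UNIV"

lemma square_summable_zero: "square_summable (\<lambda>i. 0)"
  by (simp add: square_summable_def)

lemma square_summable_comparison:
  assumes "g summable_on UNIV" "\<And>i. (cmod (f i))\<^sup>2 \<le> g i"
  shows "square_summable f"
  unfolding square_summable_def
  by (rule summable_on_comparison_test[OF assms(1)]) (auto simp: assms(2))

lemma square_summable_add:
  assumes "square_summable f" "square_summable g"
  shows "square_summable (\<lambda>i. f i + g i)"
proof (rule square_summable_comparison)
  show "(\<lambda>i. 2 * (cmod (f i))\<^sup>2 + 2 * (cmod (g i))\<^sup>2) summable_on UNIV"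
    using assms unfolding square_summable_def
    by (intro summable_on_add summable_on_cmult_right)
  fix i
  have "(cmod (f i + g i))\<^sup>2 \<le> (cmod (f i) + cmod (g i))\<^sup>2"
    by (intro power_mono norm_triangle_ineq) auto
  also have "\<dots> \<le> 2 * (cmod (f i))\<^sup>2 + 2 * (cmod (g i))\<^sup>2"
    using zero_le_power2[of "cmod (f i) - cmod (g i)"]
    by (simp add: power2_eq_square algebra_simps)
  finally show "(cmod (f i + g i))\<^sup>2 \<le> 2 * (cmod (f i))\<^sup>2 + 2 * (cmod (g i))\<^sup>2" .
qed

lemma square_summable_mult:
  assumes "square_summable f"
  shows "square_summable (\<lambda>i. c * f i)"
  using summable_on_cmult_right[OF assms[unfolded square_summable_def], of "(cmod c)\<^sup>2"]
  by (simp add: square_summable_def norm_mult power_mult_distrib)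

lemma square_summable_diff:
  assumes "square_summable f" "square_summable g"
  shows "square_summable (\<lambda>i. f i - g i)"
  using square_summable_add[OF assms(1) square_summable_mult[OF assms(2), of "-1"]] by simp

typedef 'i ell2 = "{f :: 'i \<Rightarrow> complex. square_summable f}"
  morphisms Rep_ell2 Abs_ell2
  using square_summable_zero by blast

setup_lifting type_definition_ell2

lemma square_summable_Rep_ell2: "square_summable (Rep_ell2 x)"
  using Rep_ell2 by blast

lemma Rep_Abs_ell2: "square_summable f \<Longrightarrow> Rep_ell2 (Abs_ell2 f) = f"
  by (simp add: Abs_ell2_inverse)

lemma ell2_eqI: "(\<And>i. Rep_ell2 x i = Rep_ell2 y i) \<Longrightarrow> x = y"
  by (metis Rep_ell2_inject ext)

lemma summable_mult_cnj:
  assumes "square_summable f" "square_summable g"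
  shows "(\<lambda>i. f i * cnj (g i)) summable_on UNIV"
proof (rule abs_summable_summable, rule Infinite_Sum.abs_summable_on_comparison_test)
  show "(\<lambda>i. norm ((cmod (f i))\<^sup>2 + (cmod (g i))\<^sup>2)) summable_on UNIV"
    using assms unfolding square_summable_def by (auto intro!: summable_on_add)
  fix i
  have "cmod (f i) * cmod (g i) \<le> (cmod (f i))\<^sup>2 + (cmod (g i))\<^sup>2"
    using zero_le_power2[of "cmod (f i) - cmod (g i)"]
      zero_le_power2[of "cmod (f i)"] zero_le_power2[of "cmod (g i)"]
    unfolding power2_diff by linarith
  then show "cmod (f i * cnj (g i)) \<le> norm ((cmod (f i))\<^sup>2 + (cmod (g i))\<^sup>2)"
    by (simp add: norm_mult)
qed

definition ell2_inner :: "'i ell2 \<Rightarrow> 'i ell2 \<Rightarrow> complex" where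
  "ell2_inner x y = (\<Sum>\<^sub>\<infinity>i. Rep_ell2 x i * cnj (Rep_ell2 y i))"

instantiation ell2 :: (type) real_inner
begin

lift_definition zero_ell2 :: "'a ell2" is "\<lambda>i. 0" by (rule square_summable_zero)

lift_definition plus_ell2 :: "'a ell2 \<Rightarrow> 'a ell2 \<Rightarrow> 'a ell2" is "\<lambda>f g i. f i + g i"
  by (rule square_summable_add)

lift_definition minus_ell2 :: "'a ell2 \<Rightarrow> 'a ell2 \<Rightarrow> 'a ell2" is "\<lambda>f g i. f i - g i"
  by (rule square_summable_diff)

lift_definition uminus_ell2 :: "'a ell2 \<Rightarrow> 'a ell2" is "\<lambda>f i. - f i"
  using square_summable_mult[of _ "-1"] by auto

lift_definition scaleR_ell2 :: "real \<Rightarrow> 'a ell2 \<Rightarrow> 'a ell2" is "\<lambda>r f i. complex_of_real r * f i"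
  by (rule square_summable_mult)

definition "inner x y = Re (ell2_inner x y)" for x y :: "'a ell2"

definition "norm x = sqrt (inner x x)" for x :: "'a ell2"

definition "sgn x = inverse (norm x) *\<^sub>R x" for x :: "'a ell2"

definition "dist x y = norm (x - y)" for x y :: "'a ell2"

definition "(uniformity :: ('a ell2 \<times> 'a ell2) filter) =
  (INF e\<in>{0<..}. principal {(x, y). dist x y < e})"

definition "open U \<longleftrightarrow> (\<forall>x\<in>U. \<forall>\<^sub>F (x', y) in uniformity. x' = x \<longrightarrow> y \<in> U)"
  for U :: "'a ell2 set"

instance
proof
  fix x y z :: "'a ell2" and r s :: real and U :: "'a ell2 set"
  note ss = square_summable_Rep_ell2
  note sm = summable_mult_cnj[OF ss ss]
  show "x + y + z = x + (y + z)" by transfer (simp add: add.assoc)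
  show "x + y = y + x" by transfer (simp add: add.commute)
  show "0 + x = x" by transfer simp
  show "- x + x = 0" by transfer simp
  show "x - y = x + - y" by transfer simp
  show "r *\<^sub>R (x + y) = r *\<^sub>R x + r *\<^sub>R y" by transfer (simp add: algebra_simps)
  show "(r + s) *\<^sub>R x = r *\<^sub>R x + s *\<^sub>R x" by transfer (simp add: algebra_simps)
  show "r *\<^sub>R s *\<^sub>R x = (r * s) *\<^sub>R x" by transfer (simp add: algebra_simps)
  show "1 *\<^sub>R x = x" by transfer simp
  show "dist x y = norm (x - y)" by (rule dist_ell2_def)
  show "sgn x = inverse (norm x) *\<^sub>R x" by (rule sgn_ell2_def)
  show "(uniformity :: ('a ell2 \<times> 'a ell2) filter) =
      (INF e\<in>{0<..}. principal {(x, y). dist x y < e})"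
    by (rule uniformity_ell2_def)
  show "open U \<longleftrightarrow> (\<forall>x\<in>U. \<forall>\<^sub>F (x', y) in uniformity. x' = x \<longrightarrow> y \<in> U)"
    by (rule open_ell2_def)
  show "norm x = sqrt (inner x x)" by (rule norm_ell2_def)
  have "ell2_inner x y = cnj (ell2_inner y x)"
    unfolding ell2_inner_def by (simp flip: infsum_cnj add: mult.commute)
  then show "inner x y = inner y x" by (simp add: inner_ell2_def)
  have "ell2_inner (x + y) z = ell2_inner x z + ell2_inner y z"
    unfolding ell2_inner_def plus_ell2.rep_eq
    by (simp add: algebra_simps infsum_add[OF sm sm])
  then show "inner (x + y) z = inner x z + inner y z" by (simp add: inner_ell2_def)
  have "ell2_inner (r *\<^sub>R x) y = of_real r * ell2_inner x y"
    unfolding ell2_inner_def scaleR_ell2.rep_eq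
    by (simp add: mult.assoc infsum_cmult_right')
  then show "inner (r *\<^sub>R x) y = r * inner x y" by (simp add: inner_ell2_def)
  have sq: "inner x x = (\<Sum>\<^sub>\<infinity>i. (cmod (Rep_ell2 x i))\<^sup>2)"
    unfolding inner_ell2_def ell2_inner_def by (subst infsum_Re[OF sm, symmetric])
      (simp add: complex_norm_square[symmetric] del: of_real_power)
  show "0 \<le> inner x x" unfolding sq by (rule infsum_nonneg) simp
  show "inner x x = 0 \<longleftrightarrow> x = 0"
  proof
    assume "inner x x = 0"
    then have "(cmod (Rep_ell2 x i))\<^sup>2 = 0" for i
      using nonneg_infsum_le_0D[of "\<lambda>i. (cmod (Rep_ell2 x i))\<^sup>2" UNIV i] ss[of x]
      by (auto simp: sq square_summable_def)
    then show "x = 0" by (intro ell2_eqI) (simp add: zero_ell2.rep_eq)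
  next
    assume "x = 0"
    then show "inner x x = 0" unfolding sq by (simp add: zero_ell2.rep_eq)
  qed
qed

end

lemma norm_ell2_square: "(norm x)\<^sup>2 = (\<Sum>\<^sub>\<infinity>i. (cmod (Rep_ell2 x i))\<^sup>2)" for x :: "'i ell2"
proof -
  have "(norm x)\<^sup>2 = Re (ell2_inner x x)"
    by (simp add: power2_norm_eq_inner inner_ell2_def)
  also have "\<dots> = (\<Sum>\<^sub>\<infinity>i. Re (Rep_ell2 x i * cnj (Rep_ell2 x i)))"
    unfolding ell2_inner_def
    by (rule infsum_Re[symmetric]) (intro summable_mult_cnj square_summable_Rep_ell2)
  finally show ?thesis by (simp add: complex_norm_square[symmetric] del: of_real_power)
qed

lemma sum_le_norm_ell2_square:
  assumes "finite S"
  shows "(\<Sum>i\<in>S. (cmod (Rep_ell2 x i))\<^sup>2) \<le> (norm x)\<^sup>2"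
  unfolding norm_ell2_square using square_summable_Rep_ell2[of x] assms
  by (intro finite_sum_le_infsum) (auto simp: square_summable_def)

lemma cmod_Rep_ell2_le: "cmod (Rep_ell2 x i) \<le> norm x"
  using sum_le_norm_ell2_square[of "{i}" x] by (simp add: abs_le_square_iff[symmetric])

lemma ell2_bounded_sums:
  assumes "\<And>S. finite S \<Longrightarrow> (\<Sum>i\<in>S. (cmod (f i))\<^sup>2) \<le> C\<^sup>2" and "0 \<le> C"
  shows "square_summable f" and "norm (Abs_ell2 f) \<le> C"
proof -
  show ss: "square_summable f"
    unfolding square_summable_def
    by (rule nonneg_bdd_above_summable_on) (use assms in \<open>auto simp: bdd_above_def\<close>)
  have "(norm (Abs_ell2 f))\<^sup>2 \<le> C\<^sup>2"
    unfolding norm_ell2_square Rep_Abs_ell2[OF ss]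
    using ss assms by (intro infsum_le_finite_sums) (auto simp: square_summable_def)
  then show "norm (Abs_ell2 f) \<le> C" using assms(2) by (simp add: abs_le_square_iff[symmetric])
qed

instantiation ell2 :: (type) complex_hilbert_space
begin

lift_definition scaleC_ell2 :: "complex \<Rightarrow> 'a ell2 \<Rightarrow> 'a ell2" is "\<lambda>c f i. c * f i"
  by (rule square_summable_mult)

definition "cinner x y = ell2_inner x y" for x y :: "'a ell2"

instance
proof
  fix x y z :: "'a ell2" and c d :: complex and r :: real
  note ss = square_summable_Rep_ell2
  note sm = summable_mult_cnj[OF ss ss]
  show "c *\<^sub>C (x + y) = c *\<^sub>C x + c *\<^sub>C y" by transfer (simp add: algebra_simps)
  show "(c + d) *\<^sub>C x = c *\<^sub>C x + d *\<^sub>C x" by transfer (simp add: algebra_simps)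
  show "c *\<^sub>C d *\<^sub>C x = (c * d) *\<^sub>C x" by transfer (simp add: algebra_simps)
  show "complex_of_real r *\<^sub>C x = r *\<^sub>R x" by transfer simp
  show "cinner x y = cnj (cinner y x)"
    unfolding cinner_ell2_def ell2_inner_def by (simp flip: infsum_cnj add: mult.commute)
  show "cinner (x + y) z = cinner x z + cinner y z"
    unfolding cinner_ell2_def ell2_inner_def plus_ell2.rep_eq
    by (simp add: algebra_simps infsum_add[OF sm sm])
  show "cinner (c *\<^sub>C x) y = c * cinner x y"
    unfolding cinner_ell2_def ell2_inner_def scaleC_ell2.rep_eq
    by (simp add: mult.assoc infsum_cmult_right')
  show "Re (cinner x y) = inner x y"
    by (simp add: cinner_ell2_def inner_ell2_def)
next
  fix X :: "nat \<Rightarrow> 'a ell2"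
  assume X: "Cauchy X"
  have "Cauchy (\<lambda>n. Rep_ell2 (X n) i)" for i
  proof (rule metric_CauchyI)
    fix e :: real assume "0 < e"
    then obtain M where M: "\<And>m n. m \<ge> M \<Longrightarrow> n \<ge> M \<Longrightarrow> dist (X m) (X n) < e"
      using metric_CauchyD[OF X] by blast
    have "dist (Rep_ell2 (X m) i) (Rep_ell2 (X n) i) \<le> dist (X m) (X n)" for m n
      using cmod_Rep_ell2_le[of "X m - X n" i] by (simp add: dist_norm minus_ell2.rep_eq)
    then show "\<exists>M. \<forall>m\<ge>M. \<forall>n\<ge>M. dist (Rep_ell2 (X m) i) (Rep_ell2 (X n) i) < e"
      using M by (meson le_less_trans)
  qed
  then have "\<exists>F. \<forall>i. (\<lambda>n. Rep_ell2 (X n) i) \<longlonglongrightarrow> F i"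
    by (intro choice) (simp add: Cauchy_convergent_iff convergent_def)
  then obtain F where F: "\<And>i. (\<lambda>n. Rep_ell2 (X n) i) \<longlonglongrightarrow> F i" by blast
  have close: "square_summable (\<lambda>i. Rep_ell2 (X n) i - F i) \<and>
      norm (Abs_ell2 (\<lambda>i. Rep_ell2 (X n) i - F i)) \<le> e"
    if e: "0 < e" and n: "\<And>m. m \<ge> M \<Longrightarrow> dist (X n) (X m) < e" for n M e
  proof -
    have "(\<Sum>i\<in>S. (cmod (Rep_ell2 (X n) i - F i))\<^sup>2) \<le> e\<^sup>2" if "finite S" for S
    proof (rule LIMSEQ_le_const2)
      show "(\<lambda>m. \<Sum>i\<in>S. (cmod (Rep_ell2 (X n) i - Rep_ell2 (X m) i))\<^sup>2)
          \<longlonglongrightarrow> (\<Sum>i\<in>S. (cmod (Rep_ell2 (X n) i - F i))\<^sup>2)"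
        by (intro tendsto_intros F)
      have "(\<Sum>i\<in>S. (cmod (Rep_ell2 (X n) i - Rep_ell2 (X m) i))\<^sup>2) \<le> e\<^sup>2" if "m \<ge> M" for m
      proof -
        have "(\<Sum>i\<in>S. (cmod (Rep_ell2 (X n) i - Rep_ell2 (X m) i))\<^sup>2) \<le> (norm (X n - X m))\<^sup>2"
          using sum_le_norm_ell2_square[OF \<open>finite S\<close>, of "X n - X m"]
          by (simp add: minus_ell2.rep_eq)
        also have "\<dots> \<le> e\<^sup>2"
          using n[OF that] by (intro power_mono) (auto simp: dist_norm)
        finally show ?thesis .
      qed
      then show "\<exists>N. \<forall>m\<ge>N. (\<Sum>i\<in>S. (cmod (Rep_ell2 (X n) i - Rep_ell2 (X m) i))\<^sup>2) \<le> e\<^sup>2"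
        by blast
    qed
    then show ?thesis
      using ell2_bounded_sums[of "\<lambda>i. Rep_ell2 (X n) i - F i" e] e by auto
  qed
  obtain M where "\<And>m n. m \<ge> M \<Longrightarrow> n \<ge> M \<Longrightarrow> dist (X m) (X n) < 1"
    using metric_CauchyD[OF X, of 1] by auto
  then have "square_summable (\<lambda>i. Rep_ell2 (X M) i - F i)"
    using close[of 1 M M] by auto
  from square_summable_diff[OF square_summable_Rep_ell2[of "X M"] this]
  have ssF: "square_summable F" by simp
  have "X \<longlonglongrightarrow> Abs_ell2 F"
  proof (rule metric_LIMSEQ_I)
    fix e :: real assume e: "0 < e"
    then obtain M where M: "\<And>m n. m \<ge> M \<Longrightarrow> n \<ge> M \<Longrightarrow> dist (X m) (X n) < e / 2"
      using metric_CauchyD[OF X, of "e / 2"] by auto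
    have "dist (X n) (Abs_ell2 F) < e" if "n \<ge> M" for n
    proof -
      have ss: "square_summable (\<lambda>i. Rep_ell2 (X n) i - F i)"
        and le: "norm (Abs_ell2 (\<lambda>i. Rep_ell2 (X n) i - F i)) \<le> e / 2"
        using close[of "e / 2" M n] M that e by auto
      have "X n - Abs_ell2 F = Abs_ell2 (\<lambda>i. Rep_ell2 (X n) i - F i)"
        by (rule ell2_eqI) (simp add: minus_ell2.rep_eq Rep_Abs_ell2 ss ssF)
      then show ?thesis using le e by (simp add: dist_norm)
    qed
    then show "\<exists>M. \<forall>n\<ge>M. dist (X n) (Abs_ell2 F) < e" by blast
  qed
  then show "convergent X" by (auto simp: convergent_def)
qed

end

lift_definition ell2_basis :: "'i \<Rightarrow> 'i ell2" is "\<lambda>i j. if j = i then 1 else 0"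
proof -
  fix i :: 'i
  have "(\<Sum>j\<in>S. (cmod (if j = i then 1 else 0))\<^sup>2) \<le> 1\<^sup>2" if "finite S" for S
  proof -
    have "(\<Sum>j\<in>S. (cmod (if j = i then 1 else 0))\<^sup>2) = (\<Sum>j\<in>S. if j = i then 1 else 0)"
      by (rule sum.cong) auto
    also have "\<dots> \<le> 1\<^sup>2" using that by (simp add: sum.delta)
    finally show ?thesis .
  qed
  then show "square_summable (\<lambda>j. if j = i then 1 else 0)"
    by (rule ell2_bounded_sums(1)[where C = 1, OF _ zero_le_one])
qed


section \<open>Operators\<close>

definition bounded_clinear ::
    "('a::complex_hilbert_space \<Rightarrow> 'b::complex_hilbert_space) \<Rightarrow> bool" where
  "bounded_clinear T \<longleftrightarrow> bounded_linear T \<and> (\<forall>c x. T (c *\<^sub>C x) = c *\<^sub>C T x)"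

definition cadjoint ::
    "('a::complex_hilbert_space \<Rightarrow> 'b::complex_hilbert_space) \<Rightarrow> 'b \<Rightarrow> 'a" where
  "cadjoint T = (THE S. \<forall>x y. cinner (T x) y = cinner x (S y))"

definition commutator :: "('a::complex_hilbert_space \<Rightarrow> 'a) \<Rightarrow> ('a \<Rightarrow> 'a) \<Rightarrow> 'a \<Rightarrow> 'a" where
  "commutator S T = (\<lambda>x. S (T x) - T (S x))"

definition positive_op :: "('a::complex_hilbert_space \<Rightarrow> 'a) \<Rightarrow> bool" where
  "positive_op A \<longleftrightarrow> (\<forall>x. cinner (A x) x \<in> \<real> \<and> 0 \<le> Re (cinner (A x) x))"

definition op_matrix ::
    "('a::complex_hilbert_space \<Rightarrow> 'a) \<Rightarrow> ('a \<Rightarrow> 'a) \<Rightarrow> ('a \<Rightarrow> 'a) \<Rightarrow> ('a \<Rightarrow> 'a) \<Rightarrow> 'a \<times> 'a \<Rightarrow> 'a \<times> 'a"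
  where "op_matrix A B C D = (\<lambda>(x, y). (A x + B y, C x + D y))"

definition hyponormal_pair ::
    "('a::complex_hilbert_space \<Rightarrow> 'a) \<Rightarrow> ('a \<Rightarrow> 'a) \<Rightarrow> bool" where
  "hyponormal_pair T1 T2 \<longleftrightarrow> bounded_clinear T1 \<and> bounded_clinear T2 \<and>
     positive_op (op_matrix
       (commutator (cadjoint T1) T1) (commutator (cadjoint T2) T1)
       (commutator (cadjoint T1) T2) (commutator (cadjoint T2) T2))"

definition normal_op :: "('a::complex_hilbert_space \<Rightarrow> 'a) \<Rightarrow> bool" where
  "normal_op N \<longleftrightarrow> bounded_clinear N \<and> N \<circ> cadjoint N = cadjoint N \<circ> N"

definition normal_pair :: "('a::complex_hilbert_space \<Rightarrow> 'a) \<Rightarrow> ('a \<Rightarrow> 'a) \<Rightarrow> bool" where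
  "normal_pair N1 N2 \<longleftrightarrow> normal_op N1 \<and> normal_op N2 \<and> N1 \<circ> N2 = N2 \<circ> N1"

definition cisometry ::
    "('a::complex_hilbert_space \<Rightarrow> 'b::complex_hilbert_space) \<Rightarrow> bool" where
  "cisometry J \<longleftrightarrow> bounded_clinear J \<and> (\<forall>x y. cinner (J x) (J y) = cinner x y)"

text \<open>
  The inclusion of the given space in the larger one is an isometry \<open>J\<close>; the equation
  \<open>N (J x) = J (T x)\<close> says that the range of \<open>J\<close> is invariant under \<open>N\<close> and that \<open>N\<close>
  restricts to \<open>T\<close> on it.  HOL cannot quantify over types inside a formula, so the type of
  the larger space is a parameter.  In the conclusion of a theorem, the negation at a type
  variable rules out extensions to all Hilbert spaces; as a premise, subnormality at a type
  variable used nowhere else assumes an extension to some Hilbert space.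
\<close>

definition subnormal_op ::
    "'k::complex_hilbert_space itself \<Rightarrow> ('h::complex_hilbert_space \<Rightarrow> 'h) \<Rightarrow> bool" where
  "subnormal_op _ T \<longleftrightarrow> bounded_clinear T \<and>
     (\<exists>(N :: 'k \<Rightarrow> 'k) (J :: 'h \<Rightarrow> 'k). normal_op N \<and> cisometry J \<and> (\<forall>x. N (J x) = J (T x)))"

definition subnormal_pair ::
    "'k::complex_hilbert_space itself \<Rightarrow> ('h::complex_hilbert_space \<Rightarrow> 'h) \<Rightarrow> ('h \<Rightarrow> 'h) \<Rightarrow> bool" where
  "subnormal_pair _ T1 T2 \<longleftrightarrow> bounded_clinear T1 \<and> bounded_clinear T2 \<and>
     (\<exists>(N1 :: 'k \<Rightarrow> 'k) (N2 :: 'k \<Rightarrow> 'k) (J :: 'h \<Rightarrow> 'k). normal_pair N1 N2 \<and> cisometry J \<and>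
        (\<forall>x. N1 (J x) = J (T1 x)) \<and> (\<forall>x. N2 (J x) = J (T2 x)))"


section \<open>Weighted shifts\<close>

text \<open>
  For an injective index map \<open>s\<close> and bounded weights \<open>w\<close> this is the bounded operator that maps
  the basis vector at \<open>i\<close> to \<open>w i\<close> times the basis vector at \<open>s i\<close>; see the lemmas below.
\<close>

definition basis_shift :: "('i \<Rightarrow> 'i) \<Rightarrow> ('i \<Rightarrow> real) \<Rightarrow> 'i ell2 \<Rightarrow> 'i ell2" where
  "basis_shift s w x = Abs_ell2 (\<lambda>j. if j \<in> range s
     then complex_of_real (w (inv s j)) * Rep_ell2 x (inv s j) else 0)"

context
  fixes s :: "'i \<Rightarrow> 'i" and w :: "'i \<Rightarrow> real" and C :: real
  assumes inj: "inj s" and bd: "\<And>i. \<bar>w i\<bar> \<le> C"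
begin

lemma basis_shift_aux:
  "square_summable (\<lambda>j. if j \<in> range s
     then complex_of_real (w (inv s j)) * Rep_ell2 x (inv s j) else 0)"
  "norm (basis_shift s w x) \<le> C * norm x"
proof -
  let ?f = "\<lambda>j. if j \<in> range s then complex_of_real (w (inv s j)) * Rep_ell2 x (inv s j) else 0"
  have C: "0 \<le> C" using bd[of undefined] by linarith
  have *: "(\<Sum>j\<in>S. (cmod (?f j))\<^sup>2) \<le> (C * norm x)\<^sup>2" if S: "finite S" for S
  proof -
    define R where "R = s -` S"
    have R: "finite R" unfolding R_def using S inj by (rule finite_vimageI)
    have "(\<Sum>j\<in>S. (cmod (?f j))\<^sup>2) = (\<Sum>j\<in>s ` R. (cmod (?f j))\<^sup>2)"
      by (rule sum.mono_neutral_right[OF S]) (auto simp: R_def)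
    also have "\<dots> = (\<Sum>i\<in>R. (cmod (complex_of_real (w i) * Rep_ell2 x i))\<^sup>2)"
      by (subst sum.reindex) (auto simp: inj inj_on_subset[OF inj] inv_f_f[OF inj])
    also have "\<dots> \<le> (\<Sum>i\<in>R. C\<^sup>2 * (cmod (Rep_ell2 x i))\<^sup>2)"
    proof (rule sum_mono)
      fix i
      have "\<bar>w i\<bar> * cmod (Rep_ell2 x i) \<le> C * cmod (Rep_ell2 x i)"
        by (rule mult_right_mono[OF bd]) simp
      then have "(\<bar>w i\<bar> * cmod (Rep_ell2 x i))\<^sup>2 \<le> (C * cmod (Rep_ell2 x i))\<^sup>2"
        by (rule power_mono) simp
      then show "(cmod (complex_of_real (w i) * Rep_ell2 x i))\<^sup>2 \<le> C\<^sup>2 * (cmod (Rep_ell2 x i))\<^sup>2"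
        by (simp add: norm_mult power_mult_distrib)
    qed
    also have "\<dots> \<le> C\<^sup>2 * (norm x)\<^sup>2"
      using sum_le_norm_ell2_square[OF R, of x]
      by (simp add: sum_distrib_left[symmetric] mult_left_mono)
    finally show ?thesis by (simp add: power_mult_distrib)
  qed
  show "square_summable ?f" by (rule ell2_bounded_sums[OF *]) (use C in auto)
  show "norm (basis_shift s w x) \<le> C * norm x"
    unfolding basis_shift_def by (rule ell2_bounded_sums[OF *]) (use C in auto)
qed

lemma Rep_basis_shift:
  "Rep_ell2 (basis_shift s w x) = (\<lambda>j. if j \<in> range s
     then complex_of_real (w (inv s j)) * Rep_ell2 x (inv s j) else 0)"
  unfolding basis_shift_def by (rule Rep_Abs_ell2[OF basis_shift_aux(1)])

lemma bounded_clinear_basis_shift: "bounded_clinear (basis_shift s w)"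
  unfolding bounded_clinear_def
proof (intro conjI allI bounded_linear_intro)
  fix x y :: "'i ell2" and r :: real and c :: complex
  show "basis_shift s w (x + y) = basis_shift s w x + basis_shift s w y"
    by (rule ell2_eqI) (simp add: Rep_basis_shift plus_ell2.rep_eq algebra_simps)
  show "basis_shift s w (r *\<^sub>R x) = r *\<^sub>R basis_shift s w x"
    by (rule ell2_eqI) (simp add: Rep_basis_shift scaleR_ell2.rep_eq algebra_simps)
  show "basis_shift s w (c *\<^sub>C x) = c *\<^sub>C basis_shift s w x"
    by (rule ell2_eqI) (simp add: Rep_basis_shift scaleC_ell2.rep_eq algebra_simps)
  show "norm (basis_shift s w x) \<le> norm x * C"
    using basis_shift_aux(2)[of x] by (simp add: mult.commute)
qed

lemma basis_shift_ell2_basis: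
  "basis_shift s w (ell2_basis i) = complex_of_real (w i) *\<^sub>C ell2_basis (s i)"
  by (rule ell2_eqI)
    (auto simp: Rep_basis_shift scaleC_ell2.rep_eq ell2_basis.rep_eq inv_f_f[OF inj])

end

definition weighted_shift :: "(nat \<Rightarrow> real) \<Rightarrow> nat ell2 \<Rightarrow> nat ell2" where
  "weighted_shift \<alpha> = basis_shift Suc \<alpha>"

definition weighted_shift2_fst ::
    "(nat \<times> nat \<Rightarrow> real) \<Rightarrow> (nat \<times> nat) ell2 \<Rightarrow> (nat \<times> nat) ell2" where
  "weighted_shift2_fst \<alpha> = basis_shift (\<lambda>(k1, k2). (Suc k1, k2)) \<alpha>"

definition weighted_shift2_snd ::
    "(nat \<times> nat \<Rightarrow> real) \<Rightarrow> (nat \<times> nat) ell2 \<Rightarrow> (nat \<times> nat) ell2" where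
  "weighted_shift2_snd \<beta> = basis_shift (\<lambda>(k1, k2). (k1, Suc k2)) \<beta>"

definition Berger_measure :: "(nat \<Rightarrow> real) \<Rightarrow> real measure \<Rightarrow> bool" where
  "Berger_measure \<alpha> \<mu> \<longleftrightarrow> prob_space \<mu> \<and> sets \<mu> = sets borel \<and>
     measure \<mu> {0..(onorm (weighted_shift \<alpha>))\<^sup>2} = 1 \<and>
     (\<forall>k\<ge>1. (\<Prod>i<k. (\<alpha> i)\<^sup>2) = (\<integral>t. t ^ k \<partial>\<mu>))"

text \<open>
  Since \<open>1 / 0 = 0\<close> in HOL, an atom at \<open>0\<close>, which makes \<open>1 / t\<close> non-integrable, has to be
  excluded explicitly.
\<close>

definition extremal :: "real measure \<Rightarrow> real" where
  "extremal \<sigma> = (if (AE t in \<sigma>. t \<noteq> 0) \<and> integrable \<sigma> (\<lambda>t. 1 / t)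
     then (\<integral>t. 1 / t \<partial>\<sigma>) powr (- 1 / 2) else 0)"

end

theory Submission
  imports Defs
begin

text \<open>
  Write \<open>x, X, y, Y\<close> for the squares of \<open>\<xi> 0, \<xi> 1, \<eta> 0, \<eta> 1\<close> and \<open>E\<close> for the square
  of \<open>\<eta>\<^sub>e\<close>.

  \<^emph>\<open>Subnormality of the coordinates.\<close>  The first operator is a direct sum of one copy of
  \<open>shift(a, \<xi> 1, \<xi> 2, \<dots>)\<close> and infinitely many copies of the subnormal shift with weights \<open>\<xi>\<close>.
  The moments of the first summand are those of
  \<open>(a\<^sup>2 / t) d\<nu>\<^sub>M(t) + (1 - a\<^sup>2 \<integral>1/t d\<nu>\<^sub>M) \<delta>\<^sub>0\<close>, a positive measure as soon as
  \<open>a\<close> is at most the extremal value of \<open>\<nu>\<^sub>M\<close>.  A shift with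
  such moments has the normal extension \<open>M \<otimes> U\<close>, where \<open>U\<close> is the bilateral shift and \<open>M\<close> is
  selfadjoint with a unit vector \<open>e\<close> such that the square of the norm of \<open>M\<^sup>n e\<close> is the moment of
  order \<open>n\<close>.  For \<open>M\<close> one can take the Jacobi matrix of the
  symmetric measure on the line whose image under \<open>t \<mapsto> t\<^sup>2\<close> is the given one; so the extension acts
  on a space with a countable basis (\<open>subnormal_row_shifts\<close>, \<open>subnormal_perturbed_rows\<close>).
  The second operator is treated in the same way, and since \<open>a \<eta> 0 = b \<xi> 0\<close> and
  the extremal values are in the ratio \<open>\<xi> 0 : \<eta> 0\<close>, both conditions say \<open>a\<^sup>2 y \<le> x E\<close>.
  This follows from \<open>a \<le> h\<close> when \<open>y\<close> is at most \<open>v\<close>, the smaller root of a quadratic equation that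
  expresses \<open>h\<^sup>2 y = x E\<close> (\<open>below_smaller_root\<close>).  The assumption bounds \<open>\<eta> 0\<close> rather than its
  square, but \<open>\<xi> 0 < s < a\<close> forces \<open>\<eta> 0 < b < 1\<close>, so \<open>y \<le> \<eta> 0 \<le> v\<close>.

  \<^emph>\<open>Hyponormality.\<close>  All commutators are diagonal, except that the mixed ones couple the basis
  vectors at \<open>(1, 0)\<close> and \<open>(0, 1)\<close>.  Positivity is thus one condition on a two by two
  matrix, and that condition is \<open>a \<le> h\<close> (\<open>hyponormal\<close>, \<open>hyponormality_threshold\<close>).

  \<^emph>\<open>Failure of joint subnormality.\<close>  If \<open>N\<^sub>1, N\<^sub>2\<close> is a commuting normal extension, split the
  image \<open>e\<close> of the basis vector at \<open>(0, 0)\<close> along the kernel of \<open>N\<^sub>1\<close> and its complement.  The kernel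
  of a normal operator reduces every operator that commutes with it (\<open>ker_proj_commute\<close>), so \<open>N\<^sub>2\<close>
  respects the splitting.
  The mass of \<open>e\<close> off the kernel is \<open>a\<^sup>2/x\<close> times the mass off the kernel of the neighbour at
  \<open>(0, 1)\<close>, because the two vectors have proportional moments, and
  Cauchy-Schwarz for \<open>N\<^sub>2\<close> on the kernel bounds the mass of \<open>e\<close> on the kernel from below.  As the
  two masses add up to 1, one obtains \<open>a\<^sup>2 (x Y + X y - x y) \<le> x X Y\<close>, that is, \<open>a \<le> s\<close>
  (\<open>commuting_normal_extension_bound\<close>, \<open>subnormal_bound\<close>).
\<close>

section \<open>Adjoints and isometries\<close>

lemma quadratic_nonneg_imp_linear_zero:
  fixes d q :: real
  assumes "\<And>t. 0 \<le> 2 * t * d + t\<^sup>2 * q"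
  shows "d = 0"
proof -
  define r where "r = \<bar>q\<bar> + 1"
  have r: "0 < r" "q \<le> r" by (auto simp: r_def)
  have "0 \<le> 2 * (- d / r) * d + (- d / r)\<^sup>2 * q" by (rule assms)
  also have "\<dots> \<le> 2 * (- d / r) * d + (- d / r)\<^sup>2 * r"
    using r by (intro add_left_mono mult_left_mono) auto
  also have "\<dots> = - (d\<^sup>2 / r)" using r by (simp add: power2_eq_square field_simps)
  finally have "d\<^sup>2 / r \<le> 0" by simp
  then show "d = 0" using r by (simp add: divide_le_0_iff)
qed

text \<open>
  The representing vector minimises \<open>\<parallel>z\<parallel>\<^sup>2 - 2 f z\<close>.  The parallelogram law makes every minimising
  sequence a Cauchy sequence, and the first variation vanishes at the minimum.
\<close>

theorem Riesz_representation:
  fixes f :: "'a::{real_inner, complete_space} \<Rightarrow> real"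
  assumes f: "bounded_linear f"
  shows "\<exists>z. \<forall>x. f x = inner x z"
proof -
  interpret f: bounded_linear f by (rule f)
  define G where "G z = (norm z)\<^sup>2 - 2 * f z" for z
  have lower: "- (onorm f)\<^sup>2 \<le> G z" for z
  proof -
    have "f z \<le> onorm f * norm z"
      using onorm[OF f, of z] by simp
    moreover have "0 \<le> (norm z - onorm f)\<^sup>2" by simp
    ultimately show ?thesis by (simp add: G_def power2_eq_square algebra_simps)
  qed
  define m where "m = Inf (range G)"
  have bdd: "bdd_below (range G)" by (rule bdd_belowI2) (rule lower)
  have m_le: "m \<le> G z" for z unfolding m_def by (rule cINF_lower[OF bdd]) simp
  have "\<exists>z. G z < m + 1 / Suc n" for n
    using cInf_lessD[of "range G" "m + 1 / Suc n"] by (auto simp: m_def)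
  then obtain Z where Z: "\<And>n. G (Z n) < m + 1 / Suc n" by metis
  have mid: "(norm (z - w))\<^sup>2 = 2 * (G z + G w - 2 * G ((1/2) *\<^sub>R (z + w)))" for z w
    by (simp add: G_def f.add f.scaleR power2_norm_eq_inner inner_add inner_diff inner_commute
        field_simps)
  have close: "(norm (Z i - Z j))\<^sup>2 \<le> 2 * (1 / Suc i + 1 / Suc j)" for i j
    using Z[of i] Z[of j] m_le[of "(1/2) *\<^sub>R (Z i + Z j)"] unfolding mid by simp
  have "Cauchy Z"
  proof (rule metric_CauchyI)
    fix e :: real assume e: "0 < e"
    obtain M where M: "4 / e\<^sup>2 < real M" using reals_Archimedean2 by blast
    have "dist (Z i) (Z j) < e" if "i \<ge> M" "j \<ge> M" for i j
    proof -
      have *: "1 / Suc k < e\<^sup>2 / 4" if "k \<ge> M" for k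
      proof -
        have "4 / e\<^sup>2 < real (Suc k)" using M that by simp
        then show ?thesis using e by (simp add: field_simps)
      qed
      have "(norm (Z i - Z j))\<^sup>2 < e\<^sup>2"
        using close[of i j] *[OF that(1)] *[OF that(2)] by simp
      then show ?thesis
        using e by (simp add: dist_norm power_less_imp_less_base)
    qed
    then show "\<exists>M. \<forall>i\<ge>M. \<forall>j\<ge>M. dist (Z i) (Z j) < e" by blast
  qed
  then obtain z where z: "Z \<longlonglongrightarrow> z" using Cauchy_convergent_iff convergent_def by blast
  have "(\<lambda>n. G (Z n)) \<longlonglongrightarrow> G z" unfolding G_def by (intro tendsto_intros z f.tendsto)
  moreover have "(\<lambda>n. m + 1 / Suc n) \<longlonglongrightarrow> m + 0"
    by (intro tendsto_intros) (rule LIMSEQ_Suc[OF lim_1_over_n])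
  ultimately have "G z \<le> m" using Z
    by (intro LIMSEQ_le[where X = "\<lambda>n. G (Z n)" and Y = "\<lambda>n. m + 1 / Suc n"])
      (auto intro!: less_imp_le simp del: of_nat_Suc)
  then have min: "G z \<le> G w" for w using m_le[of w] by simp
  have "inner z x - f x = 0" for x
  proof (rule quadratic_nonneg_imp_linear_zero)
    fix t
    show "0 \<le> 2 * t * (inner z x - f x) + t\<^sup>2 * inner x x"
      using min[of "z + t *\<^sub>R x"] unfolding G_def power2_norm_eq_inner
      by (simp add: f.add f.scaleR inner_add inner_commute
          power2_eq_square algebra_simps)
  qed
  then have "\<forall>x. f x = inner x z" by (simp add: inner_commute)
  then show ?thesis by blast
qed

lemma cinner_add_right: "cinner x (y + z) = cinner x y + cinner x z"
  by (metis cinner_add_left cinner_commute complex_cnj_add)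

lemma cinner_eqI:
  assumes "\<And>x. cinner x y = cinner x z"
  shows "y = z"
proof -
  have "inner (y - z) y = inner (y - z) z"
    using assms[of "y - z"] by (simp flip: Re_cinner)
  then have "inner (y - z) (y - z) = 0" by (simp add: inner_diff_right)
  then show ?thesis by simp
qed

text \<open>
  The imaginary part of an inner product is the real part after multiplication of the first argument
  by \<open>- \<i>\<close>, so for complex linear operators adjointness can be tested on the real inner product.
\<close>

lemma cinner_eq_of_Re:
  assumes S: "\<And>x. Re (cinner (T x) y) = Re (cinner x (S y))"
    and T: "\<And>c x. T (c *\<^sub>C x) = c *\<^sub>C T x"
  shows "cinner (T x) y = cinner x (S y)"
proof (rule complex_eqI)
  show "Re (cinner (T x) y) = Re (cinner x (S y))" by (rule S)
  show "Im (cinner (T x) y) = Im (cinner x (S y))"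
    using S[of "(- \<i>) *\<^sub>C x"] by (simp add: T cinner_scaleC_left)
qed

lemma cadjoint_eqI:
  assumes "\<And>x y. cinner (T x) y = cinner x (S y)"
  shows "cadjoint T = S"
  unfolding cadjoint_def
proof (rule the_equality)
  show "\<forall>x y. cinner (T x) y = cinner x (S y)" using assms by blast
  fix S' assume "\<forall>x y. cinner (T x) y = cinner x (S' y)"
  then show "S' = S" using assms by (metis cinner_eqI ext)
qed

text \<open>
  This is where completeness enters: the description operator in the definition of the adjoint
  denotes something only because the Riesz theorem provides an adjoint.
\<close>

lemma cinner_cadjoint:
  assumes "bounded_clinear T"
  shows "cinner (T x) y = cinner x (cadjoint T y)"
proof -
  have T: "bounded_linear T" "\<And>c x. T (c *\<^sub>C x) = c *\<^sub>C T x"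
    using assms by (auto simp: bounded_clinear_def)
  have "\<exists>z. \<forall>x. inner (T x) y = inner x z" for y
    by (intro Riesz_representation bounded_linear_compose[OF bounded_linear_inner_left T(1)])
  then obtain S where S: "\<And>x y. inner (T x) y = inner x (S y)" by metis
  have adj: "cinner (T x) y = cinner x (S y)" for x y
    by (rule cinner_eq_of_Re) (use S T in \<open>simp_all add: Re_cinner\<close>)
  then have "cadjoint T = S" by (rule cadjoint_eqI)
  with adj show ?thesis by simp
qed

lemma bounded_clinearI:
  assumes add: "\<And>x y. T (x + y) = T x + T y"
    and scaleC: "\<And>c x. T (c *\<^sub>C x) = c *\<^sub>C T x"
    and bound: "\<And>x. norm (T x) \<le> K * norm x"
  shows "bounded_clinear T"
  unfolding bounded_clinear_def
proof (intro conjI allI bounded_linear_intro)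
  show "T (r *\<^sub>R x) = r *\<^sub>R T x" for r x
    using scaleC[of "complex_of_real r" x] by (simp add: scaleC_of_real)
  show "norm (T x) \<le> norm x * K" for x using bound[of x] by (simp add: mult.commute)
qed (rule add scaleC)+

lemma bounded_clinear_plus:
  assumes "bounded_clinear S" "bounded_clinear T"
  shows "bounded_clinear (\<lambda>x. S x + T x)"
  using assms by (auto simp: bounded_clinear_def scaleC_add_right intro: bounded_linear_add)

lemma bounded_clinear_compose:
  assumes "bounded_clinear S" "bounded_clinear T"
  shows "bounded_clinear (\<lambda>x. S (T x))"
  using assms by (auto simp: bounded_clinear_def intro: bounded_linear_compose)

lemma cisometryI:
  assumes "\<And>x y. J (x + y) = J x + J y" "\<And>c x. J (c *\<^sub>C x) = c *\<^sub>C J x"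
    and inn: "\<And>x y. cinner (J x) (J y) = cinner x y"
  shows "cisometry J"
proof -
  have "norm (J x) = norm x" for x
    using inn[of x x] by (simp add: norm_eq_sqrt_inner flip: Re_cinner)
  then have "bounded_clinear J" using assms by (intro bounded_clinearI[where K = 1]) auto
  with inn show ?thesis by (simp add: cisometry_def)
qed

lemma cisometry_compose: "cisometry I \<Longrightarrow> cisometry J \<Longrightarrow> cisometry (\<lambda>x. I (J x))"
  by (simp add: cisometry_def bounded_clinear_compose)

text \<open>
  A normal extension of \<open>T\<close> also extends every operator that an isometry intertwines with \<open>T\<close>.
\<close>

lemma subnormal_op_restrict:
  fixes T :: "'h::complex_hilbert_space \<Rightarrow> 'h" and T' :: "'g::complex_hilbert_space \<Rightarrow> 'g"
  assumes "subnormal_op TYPE('k::complex_hilbert_space) T" "cisometry V" "bounded_clinear T'"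
    and "\<And>x. T (V x) = V (T' x)"
  shows "subnormal_op TYPE('k) T'"
proof -
  obtain N :: "'k \<Rightarrow> 'k" and J :: "'h \<Rightarrow> 'k"
    where NJ: "normal_op N" "cisometry J" "\<And>x. N (J x) = J (T x)"
    using assms(1) by (auto simp: subnormal_op_def)
  have "cisometry (\<lambda>x. J (V x))" by (rule cisometry_compose[OF NJ(2) assms(2)])
  moreover have "N (J (V x)) = J (V (T' x))" for x by (simp add: NJ(3) assms(4))
  ultimately show ?thesis
    unfolding subnormal_op_def using NJ(1) assms(3) by blast
qed

text \<open>
  The adjoint \<open>S\<close> is given by hand rather than as \<^const>\<open>cadjoint\<close> of \<open>N\<close>, since for a concrete \<open>N\<close>
  the adjoint identity is directly available.
\<close>

lemma normal_op_unitary: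
  fixes U :: "'k::complex_hilbert_space \<Rightarrow> 'l::complex_hilbert_space"
  assumes U: "cisometry U" and V: "cisometry V" and inv: "\<And>x. U (V x) = x" "\<And>x. V (U x) = x"
    and N: "bounded_clinear N" "\<And>x y. cinner (N x) y = cinner x (S y)"
    and comm: "\<And>x. N (S x) = S (N x)"
  shows "normal_op (\<lambda>x. U (N (V x)))"
proof -
  have UV: "cinner (U x) y = cinner x (V y)" for x y
    using U inv by (metis cisometry_def)
  have VU: "cinner (V x) y = cinner x (U y)" for x y
    using V inv by (metis cisometry_def)
  have adj: "cadjoint (\<lambda>x. U (N (V x))) = (\<lambda>x. U (S (V x)))"
    by (rule cadjoint_eqI) (simp add: UV N(2) VU)
  have "bounded_clinear (\<lambda>x. U (N (V x)))"
    using U V bounded_clinear_compose[OF _ bounded_clinear_compose[OF N(1)], of U V]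
    by (simp add: cisometry_def)
  then show ?thesis
    unfolding normal_op_def adj by (simp add: comp_def inv comm)
qed

section \<open>The kernel of a normal operator\<close>

text \<open>
  Only the real part of the inner product is used in what follows, hence the real Hilbert space.
\<close>

locale hilbert_normal =
  fixes N S :: "'a::{real_inner, complete_space} \<Rightarrow> 'a"
  assumes bounded: "bounded_linear N"
    and adj: "inner (N x) y = inner x (S y)"
    and comm: "N (S x) = S (N x)"

lemma hilbert_normal_of_normal_op:
  assumes "normal_op N"
  shows "hilbert_normal N (cadjoint N)"
proof (rule hilbert_normal.intro)
  have N: "bounded_clinear N" "N \<circ> cadjoint N = cadjoint N \<circ> N"
    using assms by (auto simp: normal_op_def)
  show "bounded_linear N" using N by (simp add: bounded_clinear_def)
  show "inner (N x) y = inner x (cadjoint N y)" for x y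
    using cinner_cadjoint[OF N(1), of x y] by (simp flip: Re_cinner)
  show "N (cadjoint N x) = cadjoint N (N x)" for x
    using N(2) by (metis comp_apply)
qed

context hilbert_normal
begin

interpretation N: bounded_linear N by (rule bounded)

lemma adj': "inner (S x) y = inner x (N y)"
  by (metis adj inner_commute)

lemma norm_adjoint: "norm (S x) = norm (N x)"
proof -
  have "inner (S x) (S x) = inner (N x) (N x)"
    by (metis adj comm inner_commute)
  then show ?thesis by (simp add: norm_eq_sqrt_inner)
qed

lemma adjoint_diff: "S (x - y) = S x - S y"
proof -
  have "inner z (S (x - y)) = inner z (S x - S y)" for z
    by (simp add: adj[symmetric] inner_diff_right)
  then show ?thesis by (metis vector_eq_ldot)
qed

lemma adjoint_scaleR: "S (r *\<^sub>R x) = r *\<^sub>R S x"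
proof -
  have "inner z (S (r *\<^sub>R x)) = inner z (r *\<^sub>R S x)" for z
    by (simp add: adj[symmetric])
  then show ?thesis by (metis vector_eq_ldot)
qed

lemma bounded_linear_adjoint: "bounded_linear S"
proof (rule bounded_linear_intro[where K = "onorm N"])
  fix x y
  show "S (x + y) = S x + S y"
    using adjoint_diff[of x "(- 1) *\<^sub>R y"] adjoint_scaleR[of "-1" y] by simp
  show "norm (S x) \<le> norm x * onorm N"
    by (simp add: norm_adjoint onorm[OF bounded] mult.commute)
qed (rule adjoint_scaleR)

text \<open>
  Log-convexity of \<open>n \<mapsto> \<parallel>N\<^sup>n x\<parallel>\<close>, by Cauchy-Schwarz for \<open>\<parallel>N x\<parallel>\<^sup>2 = \<langle>N\<^sup>* N x, x\<rangle>\<close>.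
\<close>

lemma norm_square_le: "(norm (N x))\<^sup>2 \<le> norm (N (N x)) * norm x"
proof -
  have "(norm (N x))\<^sup>2 = inner x (S (N x))"
    by (simp add: power2_norm_eq_inner adj)
  also have "\<dots> \<le> norm x * norm (S (N x))" by (rule norm_cauchy_schwarz)
  finally show ?thesis by (simp add: norm_adjoint mult.commute)
qed

text \<open>
  Any positive bound for \<open>\<parallel>N\<parallel>\<^sup>2\<close> would do; the summand 1 keeps it positive for \<open>N = 0\<close>.
\<close>

definition C :: real where "C = (onorm N)\<^sup>2 + 1"

lemma C_pos: "C > 0"
  unfolding C_def by (metis less_add_one order_le_less_trans zero_le_power2)

text \<open>
  The operator \<open>1 - N\<^sup>* N / C\<close> is a selfadjoint contraction that fixes exactly the kernel of \<open>N\<close>.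
  Its even powers converge strongly to the orthogonal projection onto that kernel, which gives the
  projection as a limit of polynomials in \<open>N\<^sup>* N\<close>.
\<close>

definition D :: "'a \<Rightarrow> 'a" where "D x = x - (1 / C) *\<^sub>R S (N x)"

lemma D_selfadjoint: "inner (D x) y = inner x (D y)"
  by (simp add: D_def inner_diff_left inner_diff_right adj' adj[symmetric])

lemma D_power_selfadjoint: "inner ((D ^^ n) x) y = inner x ((D ^^ n) y)"
proof (induction n arbitrary: y)
  case (Suc n)
  then show ?case using funpow_swap1[of D n y] by (simp add: D_selfadjoint)
qed simp

lemma norm_D: "(norm (D x))\<^sup>2 \<le> (norm x)\<^sup>2 - (norm (N x))\<^sup>2 / C"
proof -
  have *: "(norm (S (N x)))\<^sup>2 \<le> C * (norm (N x))\<^sup>2"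
  proof -
    have "norm (S (N x)) \<le> onorm N * norm (N x)"
      by (simp add: norm_adjoint onorm[OF bounded])
    then have "(norm (S (N x)))\<^sup>2 \<le> (onorm N * norm (N x))\<^sup>2" by (rule power_mono) simp
    also have "\<dots> \<le> C * (norm (N x))\<^sup>2" by (simp add: C_def power_mult_distrib mult_right_mono)
    finally show ?thesis .
  qed
  have iw: "inner x (S (N x)) = inner (N x) (N x)" by (simp add: adj)
  have "(norm (D x))\<^sup>2 = (norm x)\<^sup>2 - 2 * (norm (N x))\<^sup>2 / C + (norm (S (N x)))\<^sup>2 / C\<^sup>2"
    using iw unfolding D_def power2_norm_eq_inner
    by (simp add: inner_diff_left inner_diff_right inner_commute power2_eq_square)
  also have "\<dots> \<le> (norm x)\<^sup>2 - 2 * (norm (N x))\<^sup>2 / C + C * (norm (N x))\<^sup>2 / C\<^sup>2"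
    using * C_pos by (intro add_left_mono divide_right_mono) auto
  also have "\<dots> = (norm x)\<^sup>2 - (norm (N x))\<^sup>2 / C"
    using C_pos by (simp add: power2_eq_square field_simps)
  finally show ?thesis .
qed

lemma D_contraction: "norm (D x) \<le> norm x"
proof -
  have "0 \<le> (norm (N x))\<^sup>2 / C" using C_pos by simp
  then have "(norm (D x))\<^sup>2 \<le> (norm x)\<^sup>2" using norm_D[of x] by linarith
  then show ?thesis by (rule power2_le_imp_le) simp
qed

definition ker_proj :: "'a \<Rightarrow> 'a" where "ker_proj x = lim (\<lambda>n. (D ^^ (2 * n)) x)"

text \<open>
  With \<open>f k = \<parallel>D\<^sup>k x\<parallel>\<^sup>2\<close>, which decreases, selfadjointness gives
  \<open>\<parallel>D\<^bsup>2i\<^esup> x - D\<^bsup>2j\<^esup> x\<parallel>\<^sup>2 = f (2i) + f (2j) - 2 f (i + j)\<close>; so convergence of \<open>f\<close> makes the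
  sequence of vectors a Cauchy sequence.  Only even powers keep the middle term of the form \<open>f k\<close>.
\<close>

lemma tendsto_ker_proj: "(\<lambda>n. (D ^^ (2 * n)) x) \<longlonglongrightarrow> ker_proj x"
proof -
  define f where "f k = (norm ((D ^^ k) x))\<^sup>2" for k
  have inn: "inner ((D ^^ i) x) ((D ^^ j) x) = inner x ((D ^^ (i + j)) x)" for i j
    by (simp add: D_power_selfadjoint funpow_add)
  have dec: "decseq f"
    unfolding f_def by (rule decseq_SucI) (simp add: D_contraction power_mono)
  moreover have "0 \<le> f k" for k by (simp add: f_def)
  ultimately obtain l where l: "f \<longlonglongrightarrow> l" using decseq_convergent[of f 0] by blast
  have dif: "(norm ((D ^^ (2 * i)) x - (D ^^ (2 * j)) x))\<^sup>2 = f (2 * i) + f (2 * j) - 2 * f (i + j)"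
    for i j
  proof -
    have "inner x ((D ^^ (2 * i + 2 * j)) x) = f (i + j)"
      unfolding f_def power2_norm_eq_inner inn by (rule arg_cong[where f = "\<lambda>k. inner x ((D ^^ k) x)"]) simp
    then show ?thesis
      by (simp add: power2_norm_eq_inner inner_diff_left inner_diff_right f_def inner_commute
          inn add.commute)
  qed
  have "Cauchy (\<lambda>n. (D ^^ (2 * n)) x)"
  proof (rule metric_CauchyI)
    fix e :: real assume e: "0 < e"
    then have "\<forall>\<^sub>F k in sequentially. dist (f k) l < e\<^sup>2 / 4"
      by (intro tendstoD[OF l]) simp
    then obtain M where M: "\<And>k. k \<ge> M \<Longrightarrow> dist (f k) l < e\<^sup>2 / 4"
      by (auto simp: eventually_sequentially)
    have "dist ((D ^^ (2 * i)) x) ((D ^^ (2 * j)) x) < e" if "i \<ge> M" "j \<ge> M" for i j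
    proof -
      have "(norm ((D ^^ (2 * i)) x - (D ^^ (2 * j)) x))\<^sup>2 < e\<^sup>2"
        using M[of "2 * i"] M[of "2 * j"] M[of "i + j"] that unfolding dif dist_real_def
        by linarith
      then show ?thesis using e by (simp add: dist_norm power_less_imp_less_base)
    qed
    then show "\<exists>M. \<forall>i\<ge>M. \<forall>j\<ge>M. dist ((D ^^ (2 * i)) x) ((D ^^ (2 * j)) x) < e" by blast
  qed
  then show ?thesis
    unfolding ker_proj_def by (simp add: Cauchy_convergent_iff convergent_LIMSEQ_iff)
qed

text \<open>
  The limit is fixed by \<open>D\<^sup>2\<close>, hence \<open>D\<close> preserves its norm, and by \<open>norm_D\<close> the norm drops
  strictly off the kernel.
\<close>

lemma N_ker_proj: "N (ker_proj x) = 0"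
proof -
  have contD: "isCont D z" for z
  proof -
    have "D = (\<lambda>x. x - (1 / C) *\<^sub>R S (N x))" by (auto simp: D_def)
    moreover have "bounded_linear (\<lambda>x. x - (1 / C) *\<^sub>R S (N x))"
      by (intro bounded_linear_sub bounded_linear_ident bounded_linear_const_scaleR
          bounded_linear_compose[OF bounded_linear_adjoint bounded])
    ultimately show ?thesis by (simp add: linear_continuous_at)
  qed
  have "(\<lambda>n. D (D ((D ^^ (2 * n)) x))) \<longlonglongrightarrow> D (D (ker_proj x))"
    by (intro isCont_tendsto_compose[OF contD] tendsto_ker_proj)
  moreover have "(\<lambda>n. D (D ((D ^^ (2 * n)) x))) \<longlonglongrightarrow> ker_proj x"
    using LIMSEQ_Suc[OF tendsto_ker_proj[of x]] by (simp add: numeral_2_eq_2)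
  ultimately have "D (D (ker_proj x)) = ker_proj x" by (rule LIMSEQ_unique)
  then have "(norm (ker_proj x))\<^sup>2 \<le> (norm (D (ker_proj x)))\<^sup>2"
    by (metis D_contraction norm_ge_zero power_mono)
  then have "(norm (N (ker_proj x)))\<^sup>2 / C \<le> 0" using norm_D[of "ker_proj x"] by linarith
  then show ?thesis using C_pos by (simp add: divide_le_0_iff)
qed

lemma S_kernel: "N z = 0 \<Longrightarrow> S z = 0"
  using norm_adjoint[of z] by simp

lemma inner_ker_proj_kernel:
  assumes "N z = 0"
  shows "inner (ker_proj x) z = inner x z"
proof -
  have "D z = z" using assms S_kernel[of 0] by (simp add: D_def N.zero)
  then have "(D ^^ n) z = z" for n by (induction n) auto
  then have "inner ((D ^^ (2 * n)) x) z = inner x z" for n by (simp add: D_power_selfadjoint)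
  moreover have "(\<lambda>n. inner ((D ^^ (2 * n)) x) z) \<longlonglongrightarrow> inner (ker_proj x) z"
    by (intro tendsto_intros tendsto_ker_proj)
  ultimately show ?thesis by (simp add: LIMSEQ_const_iff)
qed

lemma inner_ker_proj_self: "inner (ker_proj x) x = (norm (ker_proj x))\<^sup>2"
  using inner_ker_proj_kernel[OF N_ker_proj, of x x] by (simp add: power2_norm_eq_inner inner_commute)

lemma ker_proj_unique:
  assumes "N q = 0" "\<And>z. N z = 0 \<Longrightarrow> inner q z = inner x z"
  shows "ker_proj x = q"
proof -
  have "N (ker_proj x - q) = 0" by (simp add: N.diff N_ker_proj assms)
  then have "inner (ker_proj x - q) (ker_proj x - q) = 0"
    using inner_ker_proj_kernel[of "ker_proj x - q" x] assms(2)[of "ker_proj x - q"] by (simp add: inner_diff_left)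
  then show ?thesis by simp
qed

lemma ker_proj_scaleR: "ker_proj (r *\<^sub>R x) = r *\<^sub>R ker_proj x"
  by (rule ker_proj_unique) (simp_all add: N.scaleR N_ker_proj inner_ker_proj_kernel)

text \<open>
  An operator \<open>B\<close> commuting with \<open>N\<close> maps the kernel of \<open>N\<close> into itself.  It also maps the range of
  \<open>N\<close> into itself, and the closure of the range is the orthogonal complement of the kernel because
  \<open>N\<close> is normal.  So the kernel reduces \<open>B\<close>.
\<close>

lemma ker_proj_commute:
  assumes B: "bounded_linear B" and comm': "\<And>x. B (N x) = N (B x)"
  shows "ker_proj (B x) = B (ker_proj x)"
proof (rule ker_proj_unique)
  interpret B: bounded_linear B by (rule B)
  show "N (B (ker_proj x)) = 0" by (simp add: comm'[symmetric] N_ker_proj B.zero)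
  fix z assume z: "N z = 0"
  have ran: "\<exists>w. x - (D ^^ n) x = N w" for n
  proof (induction n)
    case 0
    show ?case by (rule exI[of _ 0]) (simp add: N.zero)
  next
    case (Suc n)
    then obtain w where w: "x - (D ^^ n) x = N w" by blast
    have "x - (D ^^ Suc n) x = N (w + (1 / C) *\<^sub>R S ((D ^^ n) x))"
      using w by (simp add: D_def N.add N.scaleR comm)
    then show ?case by blast
  qed
  have "inner (B ((D ^^ n) x)) z = inner (B x) z" for n
  proof -
    obtain w where "x - (D ^^ n) x = N w" using ran by blast
    then have "B x - B ((D ^^ n) x) = N (B w)" by (simp add: comm'[symmetric] flip: B.diff)
    then have "inner (B x - B ((D ^^ n) x)) z = 0" by (simp add: adj S_kernel[OF z])
    then show ?thesis by (simp add: inner_diff_left)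
  qed
  moreover have "(\<lambda>n. inner (B ((D ^^ (2 * n)) x)) z) \<longlonglongrightarrow> inner (B (ker_proj x)) z"
    by (intro tendsto_intros B.tendsto tendsto_ker_proj)
  ultimately show "inner (B (ker_proj x)) z = inner (B x) z" by (simp add: LIMSEQ_const_iff)
qed

text \<open>
  \<open>\<parallel>x\<parallel>\<^sup>2 - \<parallel>ker_proj x\<parallel>\<^sup>2\<close> is a limit of values \<open>\<langle>p(N\<^sup>* N) x, x\<rangle>\<close> for polynomials \<open>p\<close> without
  constant term, and these are linear in the moments \<open>\<parallel>N\<^sup>k x\<parallel>\<^sup>2\<close> of positive order.
\<close>

lemma norm_ker_proj_moments:
  assumes mom: "\<And>k. k \<ge> 1 \<Longrightarrow> (norm ((N ^^ k) x))\<^sup>2 = c * (norm ((N ^^ k) y))\<^sup>2"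
  shows "(norm x)\<^sup>2 - (norm (ker_proj x))\<^sup>2 = c * ((norm y)\<^sup>2 - (norm (ker_proj y))\<^sup>2)"
proof -
  define P where "P z = S (N z)" for z
  have inP: "inner ((P ^^ j) u) u = (norm ((N ^^ j) u))\<^sup>2" for j u
  proof -
    have NS: "N ((S ^^ n) w) = (S ^^ n) (N w)" for n w by (induction n) (simp_all add: comm)
    have "(P ^^ j) u = (S ^^ j) ((N ^^ j) u)"
      by (induction j) (simp_all add: P_def NS)
    moreover have "inner ((S ^^ j) w) u = inner w ((N ^^ j) u)" for w
    proof (induction j arbitrary: u)
      case (Suc j)
      then show ?case using funpow_swap1[of N j u] by (simp add: adj')
    qed simp
    ultimately show ?thesis by (simp add: power2_norm_eq_inner)
  qed
  have Dlin: "(D ^^ n) (z - r *\<^sub>R w) = (D ^^ n) z - r *\<^sub>R (D ^^ n) w" for n r z w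
  proof (induction n)
    case (Suc n)
    have "D (z' - r *\<^sub>R w') = D z' - r *\<^sub>R D w'" for z' w'
      by (simp add: D_def N.diff N.scaleR adjoint_diff adjoint_scaleR algebra_simps)
    with Suc show ?case by simp
  qed simp
  have step: "inner ((D ^^ Suc n) z) u = inner ((D ^^ n) z) u - inner ((D ^^ n) (P z)) u / C"
    for n z u
    by (simp only: funpow_Suc_right comp_apply D_def[of z] Dlin P_def inner_diff_left
        inner_scaleR_left) simp
  have high: "j \<ge> 1 \<Longrightarrow>
      inner ((D ^^ n) ((P ^^ j) x)) x = c * inner ((D ^^ n) ((P ^^ j) y)) y" for n j
  proof (induction n arbitrary: j)
    case 0
    then show ?case using mom[of j] by (simp add: inP)
  next
    case (Suc n)
    have "P ((P ^^ j) z) = (P ^^ Suc j) z" for z by simp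
    then show ?case
      unfolding step using Suc.IH[of j] Suc.IH[of "Suc j"] Suc.prems
      by (simp add: right_diff_distrib)
  qed
  have low: "(norm x)\<^sup>2 - inner ((D ^^ n) x) x = c * ((norm y)\<^sup>2 - inner ((D ^^ n) y) y)" for n
  proof (induction n)
    case 0
    show ?case by (simp add: power2_norm_eq_inner)
  next
    case (Suc n)
    show ?case
      unfolding step using Suc high[of 1 n] by (simp add: field_simps)
  qed
  have lim: "(\<lambda>n. (norm z)\<^sup>2 - inner ((D ^^ (2 * n)) z) z) \<longlonglongrightarrow> (norm z)\<^sup>2 - (norm (ker_proj z))\<^sup>2" for z
    unfolding inner_ker_proj_self[symmetric] by (intro tendsto_intros tendsto_ker_proj)
  show ?thesis
    by (rule LIMSEQ_unique[OF lim]) (unfold low, intro tendsto_intros lim)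
qed

end

text \<open>
  Let \<open>q\<close> be the mass of \<open>y1\<close> on the kernel of \<open>N1\<close>; it is also that of \<open>y2\<close>, since the moments
  agree.  Proportional moments give \<open>e\<close> the mass \<open>c (1 - q)\<close> off the kernel.  On the kernel, \<open>N2\<close>
  maps the component of \<open>e\<close> to \<open>b\<close> times that of \<open>y1\<close> and then to \<open>b \<eta>1\<close> times that of \<open>y2\<close>, so
  log-convexity bounds the mass of \<open>e\<close> there below by \<open>(b/\<eta>1)\<^sup>2 q\<close>.  The total mass 1 is therefore at least a function of \<open>q\<close> that decreases, and
  \<open>q \<le> 1 - p/X\<close> by log-convexity for \<open>N1\<close> off the kernel.
\<close>

lemma commuting_normal_extension_bound:
  fixes e y1 y2 :: "'a::{real_inner, complete_space}"
  assumes "hilbert_normal N1 S1" "hilbert_normal N2 S2"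
    and comm12: "\<And>x. N2 (N1 x) = N1 (N2 x)"
    and unit: "norm e = 1" "norm y1 = 1" "norm y2 = 1"
    and N2e: "N2 e = b *\<^sub>R y1" and N2y: "N2 y1 = \<eta>1 *\<^sub>R y2"
    and me: "\<And>k. k \<ge> 1 \<Longrightarrow> (norm ((N1 ^^ k) e))\<^sup>2 = c * (norm ((N1 ^^ k) y1))\<^sup>2"
    and my: "\<And>k. k \<ge> 1 \<Longrightarrow> (norm ((N1 ^^ k) y2))\<^sup>2 = (norm ((N1 ^^ k) y1))\<^sup>2"
    and mom1: "(norm (N1 y1))\<^sup>2 = p" and mom2: "(norm (N1 (N1 y1)))\<^sup>2 = p * X"
    and pos: "b \<noteq> 0" "\<eta>1 \<noteq> 0" "0 < p" "0 < X" "0 \<le> c" and le: "b\<^sup>2 / \<eta>1\<^sup>2 \<le> c"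
  shows "c * (1 - (1 - p / X)) + b\<^sup>2 / \<eta>1\<^sup>2 * (1 - p / X) \<le> 1"
proof -
  interpret A: hilbert_normal N1 S1 by fact
  interpret B: hilbert_normal N2 S2 by fact
  interpret AL: bounded_linear N1 by (rule A.bounded)
  interpret BL: bounded_linear N2 by (rule B.bounded)
  let ?Q = A.ker_proj
  define q where "q = (norm (?Q y1))\<^sup>2"
  have q0: "0 \<le> q" by (simp add: q_def)
  have Qcomm: "?Q (N2 x) = N2 (?Q x)" for x
    by (rule A.ker_proj_commute[OF B.bounded comm12])
  have q2: "(norm (?Q y2))\<^sup>2 = q"
    using A.norm_ker_proj_moments[of y2 1 y1] my unit by (simp add: q_def)
  have total: "1 - (norm (?Q e))\<^sup>2 = c * (1 - q)"
    using A.norm_ker_proj_moments[of e c y1] me unit by (simp add: q_def)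
  have n1: "(norm (N2 (?Q e)))\<^sup>2 = b\<^sup>2 * q"
    by (simp add: Qcomm[symmetric] N2e A.ker_proj_scaleR q_def power_mult_distrib)
  have n2: "(norm (N2 (N2 (?Q e))))\<^sup>2 = b\<^sup>2 * \<eta>1\<^sup>2 * q"
    by (simp add: Qcomm[symmetric] N2e N2y A.ker_proj_scaleR BL.scaleR q2[symmetric] power_mult_distrib)
  have mass: "b\<^sup>2 / \<eta>1\<^sup>2 * q \<le> (norm (?Q e))\<^sup>2"
  proof (cases "q = 0")
    case False
    have "(b\<^sup>2 * q)\<^sup>2 \<le> (norm (N2 (N2 (?Q e))) * norm (?Q e))\<^sup>2"
      using B.norm_square_le[of "?Q e"] q0 by (intro power_mono) (simp_all add: n1)
    then have "b\<^sup>2 * q * (b\<^sup>2 * q) \<le> b\<^sup>2 * q * (\<eta>1\<^sup>2 * (norm (?Q e))\<^sup>2)"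
      unfolding power_mult_distrib[of _ "norm (?Q e)"] n2 by (simp add: power2_eq_square mult_ac)
    then have "b\<^sup>2 * q \<le> \<eta>1\<^sup>2 * (norm (?Q e))\<^sup>2"
      using False q0 pos by (auto simp: mult_le_cancel_left)
    then show ?thesis using pos by (simp add: field_simps)
  qed simp
  have q_le: "q \<le> 1 - p / X"
  proof -
    define w where "w = y1 - ?Q y1"
    have Nw: "N1 w = N1 y1" by (simp add: w_def AL.diff A.N_ker_proj)
    have "(norm w)\<^sup>2 = 1 - q"
      using unit(2) A.inner_ker_proj_self[of y1] unfolding w_def q_def power2_norm_eq_inner norm_eq_1
      by (simp add: inner_diff inner_commute)
    have "p\<^sup>2 \<le> (norm (N1 (N1 w)) * norm w)\<^sup>2"
      using power_mono[OF A.norm_square_le[of w], of 2] by (simp add: Nw mom1[symmetric])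
    then have "p * p \<le> p * (X * (1 - q))"
      unfolding power_mult_distrib Nw mom2 \<open>(norm w)\<^sup>2 = 1 - q\<close> by (simp add: power2_eq_square mult_ac)
    then have "p \<le> X * (1 - q)" using pos by (simp only: mult_le_cancel_left_pos)
    then show ?thesis using pos by (simp add: field_simps)
  qed
  have "c * (1 - (1 - p / X)) + b\<^sup>2 / \<eta>1\<^sup>2 * (1 - p / X)
      = c - (c - b\<^sup>2 / \<eta>1\<^sup>2) * (1 - p / X)" by (simp add: algebra_simps)
  also have "\<dots> \<le> c - (c - b\<^sup>2 / \<eta>1\<^sup>2) * q"
    using q_le le by (intro diff_left_mono mult_left_mono) auto
  also have "\<dots> \<le> 1" using total mass by (simp add: algebra_simps)
  finally show ?thesis .
qed

section \<open>Orthogonal polynomials of a symmetric functional\<close>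

text \<open>
  Integration against a symmetric probability measure on an interval of half-length \<open>\<surd>C\<close>, reduced to
  its algebraic properties: \<open>bound\<close> encodes the support and \<open>even\<close> the symmetry.
\<close>

locale symmetric_functional =
  fixes L :: "real poly \<Rightarrow> real" and C :: real
  assumes add: "L (p + q) = L p + L q"
    and smult: "L (smult r p) = r * L p"
    and nonneg: "0 \<le> L (p * p)"
    and even: "L (pcompose p [:0, -1:]) = L p"
    and bound: "L (pCons 0 p * pCons 0 p) \<le> C * L (p * p)"
    and one: "L 1 = 1"
begin

lemma diff: "L (p - q) = L p - L q"
  using add[of p "smult (-1) q"] smult[of "-1" q] by simp

text \<open>
  Cauchy-Schwarz in the degenerate case, which occurs because a measure with finite support has
  orthogonal polynomials of norm zero.
\<close>

lemma null:
  assumes "L (p * p) = 0"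
  shows "L (p * q) = 0"
proof (rule quadratic_nonneg_imp_linear_zero)
  fix t
  have "0 \<le> L ((p + smult t q) * (p + smult t q))" by (rule nonneg)
  also have "(p + smult t q) * (p + smult t q) = p * p + (smult t (p * q) + smult t (p * q)) + smult (t\<^sup>2) (q * q)"
    by (simp add: algebra_simps power2_eq_square)
  finally show "0 \<le> 2 * t * L (p * q) + t\<^sup>2 * L (q * q)"
    unfolding add smult using assms by simp
qed

text \<open>
  The monic orthogonal polynomials.  By symmetry their three-term recurrence has no diagonal
  coefficient.  Once a polynomial has norm zero, so have all later ones, and the recurrence
  coefficients are 0 from there on, by division by zero where both norms vanish.
\<close>

fun P :: "nat \<Rightarrow> real poly" where
  "P 0 = 1"
| "P (Suc 0) = [:0, 1:]"
| "P (Suc (Suc n)) = pCons 0 (P (Suc n)) -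
     smult (L (P (Suc n) * P (Suc n)) / L (P n * P n)) (P n)"

definition H :: "nat \<Rightarrow> real" where "H n = L (P n * P n)"

lemma H_nonneg: "0 \<le> H n" by (simp add: H_def nonneg)

lemma H_0: "H 0 = 1" by (simp add: H_def one)

lemma P_Suc_Suc: "P (Suc (Suc n)) = pCons 0 (P (Suc n)) - smult (H (Suc n) / H n) (P n)"
  unfolding H_def by (rule P.simps(3))

declare P.simps(3) [simp del]

lemma X_P_Suc: "pCons 0 (P (Suc n)) = P (Suc (Suc n)) + smult (H (Suc n) / H n) (P n)"
  by (simp add: P_Suc_Suc)

lemma X_P_0: "pCons 0 (P 0) = P (Suc 0)"
  by (simp add: one_pCons)

lemma P_parity: "pcompose (P n) [:0, -1:] = smult ((-1) ^ n) (P n)"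
proof (induction n rule: P.induct)
  case (3 n)
  then show ?case
    by (simp add: P_Suc_Suc pcompose_diff pcompose_pCons pcompose_smult smult_diff_right mult_ac)
qed (simp_all add: pcompose_pCons pcompose_1)

lemma L_X_P_P: "L (pCons 0 (P n) * P n) = 0"
proof -
  have "pcompose (pCons 0 (P n) * P n) [:0, -1:] = smult (-1) (pCons 0 (P n) * P n)"
    by (simp add: pcompose_mult pcompose_pCons P_parity flip: power_mult_distrib)
  then have "L (pCons 0 (P n) * P n) = - L (pCons 0 (P n) * P n)"
    using even[of "pCons 0 (P n) * P n"] smult[of "-1" "pCons 0 (P n) * P n"] by simp
  then show ?thesis by simp
qed

text \<open>
  In \<open>X P\<^sub>n = P\<^sub>n\<^sub>+\<^sub>1 + \<beta> P\<^sub>n\<^sub>-\<^sub>1\<close> the two terms are orthogonal, so multiplication by \<open>X\<close> bounds the norm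
  of the first one.  The orthogonality is a premise because the bound is needed inside the induction
  that proves it.
\<close>

lemma H_Suc_le_aux:
  assumes "\<And>m. n = Suc m \<Longrightarrow> L (P (Suc n) * P m) = 0"
  shows "H (Suc n) \<le> C * H n"
proof (cases n)
  case 0
  then show ?thesis using bound[of "P 0"] unfolding X_P_0 H_def by simp
next
  case (Suc m)
  let ?b = "H n / H m"
  have square: "pCons 0 (P n) * pCons 0 (P n) =
      P (Suc n) * P (Suc n) + (smult ?b (P (Suc n) * P m) + smult ?b (P (Suc n) * P m)) +
      smult (?b\<^sup>2) (P m * P m)"
    unfolding Suc X_P_Suc by (simp add: algebra_simps power2_eq_square)
  have "L (pCons 0 (P n) * pCons 0 (P n)) = H (Suc n) + ?b\<^sup>2 * H m"
    unfolding square add smult using assms[OF Suc] by (simp add: H_def)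
  moreover have "0 \<le> ?b\<^sup>2 * H m" using H_nonneg by simp
  ultimately show ?thesis using bound[of "P n"] by (simp add: H_def)
qed

lemma orthogonal: "m < n \<Longrightarrow> L (P n * P m) = 0"
proof (induction n arbitrary: m rule: less_induct)
  case (less n)
  consider "n = 1" | n' where "n = Suc (Suc n')"
    using less.prems by (metis One_nat_def less_nat_zero_code not0_implies_Suc)
  then show ?case
  proof cases
    case 1
    then show ?thesis using less.prems L_X_P_P[of 0] unfolding X_P_0 by simp
  next
    case (2 k)
    have IH: "L (P i * P j) = 0" if "j < i" "i \<le> Suc k" for i j
      using less.IH[of i j] that 2 by simp
    have ex: "L (P n * P m) = L (P (Suc k) * pCons 0 (P m)) - H (Suc k) / H k * L (P k * P m)"
      unfolding 2 P_Suc_Suc by (simp add: left_diff_distrib diff smult)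
    consider "m = Suc k" | "m = k" | "m < k" using less.prems 2 by linarith
    then show ?thesis
    proof cases
      case 1
      then show ?thesis
        using ex L_X_P_P[of "Suc k"] IH[of k "Suc k"] by (simp add: mult.commute)
    next
      case c: 2
      have top: "L (P (Suc k) * pCons 0 (P k)) = H (Suc k)"
      proof (cases k)
        case 0
        then show ?thesis by (metis H_def X_P_0)
      next
        case (Suc j)
        have "L (P (Suc k) * pCons 0 (P k)) = H (Suc k) + H k / H j * L (P (Suc k) * P j)"
          unfolding Suc X_P_Suc by (simp add: distrib_left add smult H_def)
        then show ?thesis using IH[of j "Suc k"] Suc by simp
      qed
      have "H (Suc k) \<le> C * H k" by (rule H_Suc_le_aux) (use IH in auto)
      then have "H k = 0 \<Longrightarrow> H (Suc k) = 0" using H_nonneg[of "Suc k"] by simp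
      then show ?thesis using ex top c by (auto simp: H_def)
    next
      case 3
      have "L (P (Suc k) * pCons 0 (P m)) = 0"
      proof (cases m)
        case 0
        then show ?thesis using IH[of 1 "Suc k"] 3 X_P_0 by simp
      next
        case (Suc j)
        show ?thesis
          unfolding Suc X_P_Suc using IH[of "Suc (Suc j)" "Suc k"] IH[of j "Suc k"] 3 Suc
          by (simp add: distrib_left add smult)
      qed
      then show ?thesis using ex IH[of m k] 3 by simp
    qed
  qed
qed

lemma H_Suc_le: "H (Suc n) \<le> C * H n"
  by (rule H_Suc_le_aux) (simp add: orthogonal)

text \<open>
  The off-diagonal entries of the Jacobi matrix, that is, of multiplication by \<open>X\<close> in the orthonormal
  basis \<open>P j / \<surd>(H j)\<close>.
\<close>

definition c :: "nat \<Rightarrow> real" where "c n = sqrt (H (Suc n) / H n)"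

text \<open>
  The coordinates of the monomial \<open>X\<^sup>k\<close> in the orthonormal basis; equivalently, the \<open>k\<close>-th power of
  the Jacobi matrix applied to the first basis vector.
\<close>

definition w :: "nat \<Rightarrow> nat \<Rightarrow> real" where "w k j = L (monom 1 k * P j) / sqrt (H j)"

lemma c_nonneg: "0 \<le> c n" by (simp add: c_def H_nonneg)

lemma C_nonneg: "0 \<le> C"
  using H_Suc_le[of 0] H_nonneg[of "Suc 0"] by (simp add: H_0)

lemma c_le: "c n \<le> sqrt C"
proof -
  have "H (Suc n) / H n \<le> C"
    using H_Suc_le[of n] H_nonneg[of n] C_nonneg
    by (cases "H n = 0") (simp_all add: divide_le_eq)
  then show ?thesis by (simp add: c_def)
qed

lemma L_P_null: "H j = 0 \<Longrightarrow> L (q * P j) = 0"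
  using null[of "P j" q] by (simp add: H_def mult.commute)

lemma w_0: "w 0 j = (if j = 0 then 1 else 0)"
  using orthogonal[of 0 j] by (simp add: w_def H_0 one)

lemma c_w: "c j * w k (Suc j) = L (monom 1 k * P (Suc j)) / sqrt (H j)"
proof (cases "H (Suc j) = 0")
  case True
  then show ?thesis by (simp add: L_P_null w_def)
next
  case False
  then show ?thesis by (simp add: c_def w_def real_sqrt_divide)
qed

lemma c_w': "c j * w k j = L (monom 1 k * smult (H (Suc j) / H j) (P j)) / sqrt (H (Suc j))"
proof (cases "H (Suc j) = 0")
  case False
  then have "H j \<noteq> 0" using H_Suc_le[of j] H_nonneg[of "Suc j"] by auto
  with False show ?thesis
    using H_nonneg[of j] H_nonneg[of "Suc j"]
    by (simp add: c_def w_def real_sqrt_divide smult field_simps)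
qed (simp add: c_def)

lemma w_Suc_0: "w (Suc k) 0 = c 0 * w k (Suc 0)"
proof -
  have "monom 1 (Suc k) * P 0 = monom 1 k * P (Suc 0)"
    by (simp add: monom_Suc mult.commute[of "monom 1 k"])
  then show ?thesis by (simp add: c_w) (simp add: w_def)
qed

lemma w_Suc_Suc: "w (Suc k) (Suc j) = c j * w k j + c (Suc j) * w k (Suc (Suc j))"
proof -
  have "monom 1 (Suc k) * P (Suc j) = monom 1 k * pCons 0 (P (Suc j))"
    by (simp add: monom_Suc)
  also have "\<dots> = monom 1 k * P (Suc (Suc j)) + monom 1 k * smult (H (Suc j) / H j) (P j)"
    by (simp add: X_P_Suc distrib_left)
  finally show ?thesis
    unfolding c_w c_w' by (simp add: w_def add add_divide_distrib)
qed

lemma w_eq_0: "k < j \<Longrightarrow> w k j = 0"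
proof (induction k arbitrary: j)
  case (Suc k)
  then show ?case by (cases j) (simp_all add: w_Suc_Suc)
qed (simp add: w_0)

text \<open>
  The Jacobi matrix is symmetric.  The sums are cut off at a \<open>K\<close> beyond the support of both vectors.
\<close>

lemma w_symmetric:
  assumes "k < K" "l < K"
  shows "(\<Sum>j\<le>K. w (Suc k) j * w l j) = (\<Sum>j\<le>K. w k j * w (Suc l) j)"
proof -
  have half: "(\<Sum>j\<le>K. w (Suc k) j * w l j) =
      (\<Sum>j<K. c j * w k (Suc j) * w l j) + (\<Sum>j<K. c j * w k j * w l (Suc j))"
    if "k < K" "l < K" for k l
  proof -
    have "(\<Sum>j\<le>K. w (Suc k) j * w l j)
        = w (Suc k) 0 * w l 0 + (\<Sum>j<K. w (Suc k) (Suc j) * w l (Suc j))"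
      by (simp add: lessThan_Suc_atMost[symmetric] sum.lessThan_Suc_shift del: sum.lessThan_Suc)
    also have "(\<Sum>j<K. w (Suc k) (Suc j) * w l (Suc j)) = (\<Sum>j<K. c j * w k j * w l (Suc j))
        + (\<Sum>j<K. c (Suc j) * w k (Suc (Suc j)) * w l (Suc j))"
      by (simp add: w_Suc_Suc sum.distrib algebra_simps)
    also have "w (Suc k) 0 * w l 0 + (\<dots>) = (\<Sum>j<K. c j * w k j * w l (Suc j)) +
        (\<Sum>j<Suc K. c j * w k (Suc j) * w l j)"
      by (simp add: sum.lessThan_Suc_shift w_Suc_0 del: sum.lessThan_Suc)
    also have "(\<Sum>j<Suc K. c j * w k (Suc j) * w l j) = (\<Sum>j<K. c j * w k (Suc j) * w l j)"
      using that by (simp add: w_eq_0)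
    finally show ?thesis by simp
  qed
  have "(\<Sum>j\<le>K. w k j * w (Suc l) j) = (\<Sum>j\<le>K. w (Suc l) j * w k j)"
    by (simp add: mult.commute)
  then show ?thesis unfolding half[OF assms] half[OF assms(2,1)] by (simp add: mult_ac)
qed

text \<open>
  Parseval's identity, obtained by moving all powers of the symmetric Jacobi matrix to one side.
\<close>

lemma sum_w_square: "(\<Sum>j\<le>n. (w n j)\<^sup>2) = L (monom 1 (2 * n))"
proof -
  have shift: "(\<Sum>j\<le>2 * n + 1. w n j * w n j) = (\<Sum>j\<le>2 * n + 1. w (n + i) j * w (n - i) j)"
    if "i \<le> n" for i
    using that
  proof (induction i)
    case (Suc i)
    then have "n - i = Suc (n - Suc i)" by simp
    then show ?case using Suc w_symmetric[of "n + i" "2 * n + 1" "n - Suc i"] by simp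
  qed simp
  have "(\<Sum>j\<le>n. (w n j)\<^sup>2) = (\<Sum>j\<le>2 * n + 1. w n j * w n j)"
    by (rule sum.mono_neutral_cong_left) (auto simp: w_eq_0 power2_eq_square)
  also have "\<dots> = (\<Sum>j\<le>2 * n + 1. if j = 0 then w (2 * n) 0 else 0)"
    unfolding shift[OF order_refl] by (intro sum.cong) (auto simp: w_0 mult_2)
  also have "\<dots> = L (monom 1 (2 * n))" by (simp add: w_def H_0)
  finally show ?thesis .
qed

text \<open>
  If the squared weights of a shift have the even moments of \<open>L\<close> as partial products, the normalised
  powers \<open>v n\<close> of the Jacobi matrix \<open>c\<close> at the first basis vector satisfy \<open>c \<cdot> v n = w n v (n + 1)\<close>:
  they form an orbit on which the matrix acts with exactly the weights of the shift.
\<close>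

lemma ex_jacobi_model:
  fixes w :: "nat \<Rightarrow> real"
  assumes pos: "\<And>n. 0 < w n" and mom: "\<And>n. L (monom 1 (2 * n)) = (\<Prod>i<n. (w i)\<^sup>2)"
  shows "\<exists>c v. (\<forall>j. \<bar>c j\<bar> \<le> sqrt C) \<and> (\<forall>n. (\<Sum>j\<le>n. (v n j)\<^sup>2) = 1) \<and>
    (\<forall>n j. n < j \<longrightarrow> v n j = 0) \<and> (\<forall>n. w n * v (Suc n) 0 = c 0 * v n 1) \<and>
    (\<forall>n j. w n * v (Suc n) (Suc j) = c j * v n j + c (Suc j) * v n (Suc (Suc j)))"
proof -
  define G where "G n = (\<Prod>i<n. w i)" for n
  have G: "0 < G n" for n unfolding G_def by (intro prod_pos) (use pos in auto)
  define v where "v n j = local.w n j / G n" for n j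
  have G_Suc: "w n * (z / G (Suc n)) = z / G n" for n z
    using pos[of n] by (simp add: G_def)
  have "(\<Sum>j\<le>n. (v n j)\<^sup>2) = L (monom 1 (2 * n)) / (G n)\<^sup>2" for n
    by (simp add: v_def power_divide sum_w_square flip: sum_divide_distrib)
  then have "(\<Sum>j\<le>n. (v n j)\<^sup>2) = 1" for n
    using G[of n] by (simp add: mom flip: prod_power_distrib G_def)
  moreover have "\<bar>c j\<bar> \<le> sqrt C" for j using c_le[of j] c_nonneg[of j] by simp
  moreover have "w n * v (Suc n) 0 = c 0 * v n 1" for n
    unfolding v_def G_Suc by (simp add: w_Suc_0)
  moreover have "w n * v (Suc n) (Suc j) = c j * v n j + c (Suc j) * v n (Suc (Suc j))" for n j
    unfolding v_def G_Suc by (simp add: w_Suc_Suc add_divide_distrib)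
  moreover have "n < j \<Longrightarrow> v n j = 0" for n j by (simp add: v_def w_eq_0)
  ultimately show ?thesis by blast
qed

end

section \<open>Operators on square-summable families\<close>

lemma cinner_ell2: "cinner x y = (\<Sum>\<^sub>\<infinity>i. Rep_ell2 x i * cnj (Rep_ell2 y i))"
  by (simp add: cinner_ell2_def ell2_inner_def)

text \<open>
  For injective \<open>f\<close>, the isometry that relabels the basis along \<open>f\<close> and vanishes off the range.
\<close>

definition embed :: "('i \<Rightarrow> 'j) \<Rightarrow> 'i ell2 \<Rightarrow> 'j ell2" where
  "embed f x = Abs_ell2 (\<lambda>j. if j \<in> range f then Rep_ell2 x (inv f j) else 0)"

context
  fixes f :: "'i \<Rightarrow> 'j"
  assumes inj: "inj f"
begin

lemma Rep_embed: "Rep_ell2 (embed f x) = (\<lambda>j. if j \<in> range f then Rep_ell2 x (inv f j) else 0)"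
  unfolding embed_def
proof (rule Rep_Abs_ell2)
  have "(\<lambda>j. (cmod (if j \<in> range f then Rep_ell2 x (inv f j) else 0))\<^sup>2) summable_on UNIV
      \<longleftrightarrow> (\<lambda>j. (cmod (Rep_ell2 x (inv f j)))\<^sup>2) summable_on range f"
    by (rule summable_on_cong_neutral) auto
  also have "\<dots> \<longleftrightarrow> (\<lambda>i. (cmod (Rep_ell2 x i))\<^sup>2) summable_on UNIV"
    unfolding summable_on_reindex[OF inj] by (simp add: comp_def inv_f_f[OF inj])
  finally show "square_summable (\<lambda>j. if j \<in> range f then Rep_ell2 x (inv f j) else 0)"
    using square_summable_Rep_ell2[of x] by (simp add: square_summable_def)
qed

lemma Rep_embed_image: "Rep_ell2 (embed f x) (f i) = Rep_ell2 x i"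
  by (simp add: Rep_embed inv_f_f[OF inj])

lemma cisometry_embed: "cisometry (embed f)"
proof (rule cisometryI)
  show "embed f (x + y) = embed f x + embed f y" for x y
    by (rule ell2_eqI) (simp add: Rep_embed plus_ell2.rep_eq)
  show "embed f (c *\<^sub>C x) = c *\<^sub>C embed f x" for c x
    by (rule ell2_eqI) (simp add: Rep_embed scaleC_ell2.rep_eq)
  fix x y
  have "cinner (embed f x) (embed f y) =
      (\<Sum>\<^sub>\<infinity>j\<in>range f. Rep_ell2 (embed f x) j * cnj (Rep_ell2 (embed f y) j))"
    unfolding cinner_ell2 by (rule infsum_cong_neutral) (auto simp: Rep_embed)
  also have "\<dots> = cinner x y"
    unfolding infsum_reindex[OF inj] cinner_ell2 by (simp add: comp_def Rep_embed_image)
  finally show "cinner (embed f x) (embed f y) = cinner x y" .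
qed

end

lemma embed_inverse:
  assumes "bij f"
  shows "embed f (embed (inv f) x) = x"
proof (rule ell2_eqI)
  fix j
  have "inj f" "inj (inv f)" "j = f (inv f j)"
    using assms by (auto simp: bij_is_inj bij_imp_bij_inv bij_is_surj surj_f_inv_f)
  then show "Rep_ell2 (embed f (embed (inv f) x)) j = Rep_ell2 x j"
    using Rep_embed_image[of f "embed (inv f) x" "inv f j"] Rep_embed_image[of "inv f" x j] by simp
qed

text \<open>
  For unit vectors \<open>v i\<close>, the isometry \<open>e\<^sub>i \<mapsto> e\<^sub>i \<otimes> v i\<close>.
\<close>

definition spread :: "('i \<Rightarrow> 'j \<Rightarrow> real) \<Rightarrow> 'i ell2 \<Rightarrow> ('i \<times> 'j) ell2" where
  "spread v x = Abs_ell2 (\<lambda>(i, j). Rep_ell2 x i * complex_of_real (v i j))"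

context
  fixes v :: "'i \<Rightarrow> 'j \<Rightarrow> real"
  assumes unit: "\<And>i. ((\<lambda>j. (v i j)\<^sup>2) has_sum 1) UNIV"
begin

lemma Rep_spread: "Rep_ell2 (spread v x) = (\<lambda>(i, j). Rep_ell2 x i * complex_of_real (v i j))"
  unfolding spread_def
proof (rule Rep_Abs_ell2)
  have "(\<lambda>(i, j). (cmod (Rep_ell2 x i))\<^sup>2 * (v i j)\<^sup>2) summable_on (SIGMA i:UNIV. UNIV)"
  proof (rule summable_on_SigmaI)
    show "((\<lambda>j. case (i, j) of (i, j) \<Rightarrow> (cmod (Rep_ell2 x i))\<^sup>2 * (v i j)\<^sup>2) has_sum
        (cmod (Rep_ell2 x i))\<^sup>2) UNIV" for i
      using has_sum_cmult_right[OF unit, of "(cmod (Rep_ell2 x i))\<^sup>2" i] by simp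
    show "(\<lambda>i. (cmod (Rep_ell2 x i))\<^sup>2) summable_on UNIV"
      using square_summable_Rep_ell2[of x] by (simp add: square_summable_def)
  qed auto
  then show "square_summable (\<lambda>(i, j). Rep_ell2 x i * complex_of_real (v i j))"
    by (simp add: square_summable_def case_prod_unfold norm_mult power_mult_distrib)
qed

lemma cisometry_spread: "cisometry (spread v)"
proof (rule cisometryI)
  show "spread v (x + y) = spread v x + spread v y" for x y
    by (rule ell2_eqI) (simp add: Rep_spread plus_ell2.rep_eq case_prod_unfold algebra_simps)
  show "spread v (c *\<^sub>C x) = c *\<^sub>C spread v x" for c x
    by (rule ell2_eqI) (simp add: Rep_spread scaleC_ell2.rep_eq case_prod_unfold)
  fix x y
  let ?g = "\<lambda>i j. Rep_ell2 (spread v x) (i, j) * cnj (Rep_ell2 (spread v y) (i, j))"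
  have "(\<lambda>p. Rep_ell2 (spread v x) p * cnj (Rep_ell2 (spread v y) p)) summable_on UNIV"
    by (rule summable_mult_cnj[OF square_summable_Rep_ell2 square_summable_Rep_ell2])
  then have sm: "(\<lambda>(i, j). ?g i j) summable_on (SIGMA i:UNIV. UNIV)"
    by (simp add: case_prod_unfold)
  have "cinner (spread v x) (spread v y) = (\<Sum>\<^sub>\<infinity>(i, j)\<in>(SIGMA i:UNIV. UNIV). ?g i j)"
    by (simp add: cinner_ell2 case_prod_unfold)
  also have "\<dots> = (\<Sum>\<^sub>\<infinity>i. \<Sum>\<^sub>\<infinity>j. ?g i j)" by (rule infsum_Sigma'_banach[OF sm, symmetric])
  also have "(\<lambda>i. \<Sum>\<^sub>\<infinity>j. ?g i j) = (\<lambda>i. Rep_ell2 x i * cnj (Rep_ell2 y i))"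
  proof
    fix i
    have "((\<lambda>j. complex_of_real ((v i j)\<^sup>2)) has_sum complex_of_real 1) UNIV"
      by (rule has_sum_of_real[OF unit])
    then have "((\<lambda>j. Rep_ell2 x i * cnj (Rep_ell2 y i) * complex_of_real ((v i j)\<^sup>2)) has_sum
        Rep_ell2 x i * cnj (Rep_ell2 y i) * complex_of_real 1) UNIV"
      by (rule has_sum_cmult_right)
    moreover have "?g i = (\<lambda>j. Rep_ell2 x i * cnj (Rep_ell2 y i) * complex_of_real ((v i j)\<^sup>2))"
      by (auto simp: Rep_spread power2_eq_square mult_ac)
    ultimately show "(\<Sum>\<^sub>\<infinity>j. ?g i j) = Rep_ell2 x i * cnj (Rep_ell2 y i)"
      by (simp add: infsumI)
  qed
  finally show "cinner (spread v x) (spread v y) = cinner x y" by (simp add: cinner_ell2)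
qed

end

text \<open>
  The adjoint of \<^const>\<open>basis_shift\<close>.
\<close>

definition basis_coshift :: "('i \<Rightarrow> 'i) \<Rightarrow> ('i \<Rightarrow> real) \<Rightarrow> 'i ell2 \<Rightarrow> 'i ell2" where
  "basis_coshift s w x = Abs_ell2 (\<lambda>i. complex_of_real (w i) * Rep_ell2 x (s i))"

context
  fixes s :: "'i \<Rightarrow> 'i" and w :: "'i \<Rightarrow> real" and C :: real
  assumes inj: "inj s" and bd: "\<And>i. \<bar>w i\<bar> \<le> C"
begin

lemma Rep_basis_shift_image: "Rep_ell2 (basis_shift s w x) (s i) = complex_of_real (w i) * Rep_ell2 x i"
  by (simp add: Rep_basis_shift[OF inj bd] inv_f_f[OF inj])

lemma Rep_basis_shift_outside: "j \<notin> range s \<Longrightarrow> Rep_ell2 (basis_shift s w x) j = 0"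
  by (simp add: Rep_basis_shift[OF inj bd])

lemma basis_coshift_aux:
  "square_summable (\<lambda>i. complex_of_real (w i) * Rep_ell2 x (s i))"
  "norm (basis_coshift s w x) \<le> C * norm x"
proof -
  have C: "0 \<le> C" using bd[of undefined] by linarith
  have *: "(\<Sum>i\<in>S. (cmod (complex_of_real (w i) * Rep_ell2 x (s i)))\<^sup>2) \<le> (C * norm x)\<^sup>2"
    if S: "finite S" for S
  proof -
    have "(\<Sum>i\<in>S. (cmod (complex_of_real (w i) * Rep_ell2 x (s i)))\<^sup>2)
        \<le> (\<Sum>i\<in>S. C\<^sup>2 * (cmod (Rep_ell2 x (s i)))\<^sup>2)"
      using bd C by (intro sum_mono)
        (simp add: norm_mult power_mult_distrib abs_le_square_iff[symmetric] mult_right_mono)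
    also have "\<dots> = C\<^sup>2 * (\<Sum>j\<in>s ` S. (cmod (Rep_ell2 x j))\<^sup>2)"
      by (simp add: sum.reindex inj_on_subset[OF inj] sum_distrib_left)
    also have "\<dots> \<le> C\<^sup>2 * (norm x)\<^sup>2"
      using S by (intro mult_left_mono sum_le_norm_ell2_square) auto
    finally show ?thesis by (simp add: power_mult_distrib)
  qed
  show "square_summable (\<lambda>i. complex_of_real (w i) * Rep_ell2 x (s i))"
    by (rule ell2_bounded_sums[OF *]) (use C in auto)
  show "norm (basis_coshift s w x) \<le> C * norm x"
    unfolding basis_coshift_def by (rule ell2_bounded_sums[OF *]) (use C in auto)
qed

lemma Rep_basis_coshift:
  "Rep_ell2 (basis_coshift s w x) = (\<lambda>i. complex_of_real (w i) * Rep_ell2 x (s i))"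
  unfolding basis_coshift_def by (rule Rep_Abs_ell2[OF basis_coshift_aux(1)])

lemma bounded_clinear_basis_coshift: "bounded_clinear (basis_coshift s w)"
proof (rule bounded_clinearI)
  show "basis_coshift s w (x + y) = basis_coshift s w x + basis_coshift s w y" for x y
    by (rule ell2_eqI) (simp add: Rep_basis_coshift plus_ell2.rep_eq algebra_simps)
  show "basis_coshift s w (c *\<^sub>C x) = c *\<^sub>C basis_coshift s w x" for c x
    by (rule ell2_eqI) (simp add: Rep_basis_coshift scaleC_ell2.rep_eq)
qed (rule basis_coshift_aux(2))

lemma cinner_basis_shift: "cinner (basis_shift s w x) y = cinner x (basis_coshift s w y)"
proof -
  have "cinner (basis_shift s w x) y =
      (\<Sum>\<^sub>\<infinity>j\<in>range s. Rep_ell2 (basis_shift s w x) j * cnj (Rep_ell2 y j))"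
    unfolding cinner_ell2 by (rule infsum_cong_neutral) (auto simp: Rep_basis_shift_outside)
  also have "\<dots> = cinner x (basis_coshift s w y)"
    unfolding infsum_reindex[OF inj] cinner_ell2
    by (simp add: comp_def Rep_basis_shift_image Rep_basis_coshift mult_ac)
  finally show ?thesis .
qed

lemma cinner_basis_coshift: "cinner (basis_coshift s w x) y = cinner x (basis_shift s w y)"
  by (metis cinner_basis_shift cinner_commute)

end

section \<open>Normal extensions of direct sums of weighted shifts\<close>

text \<open>
  For each row \<open>r\<close> a Jacobi matrix with zero diagonal and entries \<open>c r\<close>.  On the basis indexed by
  \<open>((r, m), j)\<close>, where \<open>m\<close> is the position of a bilateral shift, the operator \<open>N\<close> is the direct sum
  over \<open>r\<close> of bilateral shift \<open>\<otimes>\<close> Jacobi matrix.  It raises \<open>m\<close> by 1 and moves \<open>j\<close> up (\<open>up\<close>) or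
  down (the adjoint of \<open>dn\<close>).
  Normality holds because the bilateral shift is unitary and the Jacobi matrix is selfadjoint.
\<close>

locale jacobi_rows =
  fixes c :: "nat \<Rightarrow> nat \<Rightarrow> real" and K :: real
  assumes c_bound: "\<bar>c r j\<bar> \<le> K"
begin

definition up :: "(nat \<times> int) \<times> nat \<Rightarrow> (nat \<times> int) \<times> nat"
  where "up = (\<lambda>((r, m), j). ((r, m + 1), Suc j))"

definition dn :: "(nat \<times> int) \<times> nat \<Rightarrow> (nat \<times> int) \<times> nat"
  where "dn = (\<lambda>((r, m), j). ((r, m - 1), Suc j))"

definition cc :: "(nat \<times> int) \<times> nat \<Rightarrow> real" where "cc = (\<lambda>((r, m), j). c r j)"

definition N where "N x = basis_shift up cc x + basis_coshift dn cc x"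

definition N' where "N' x = basis_coshift up cc x + basis_shift dn cc x"

lemma inj_up: "inj up" and inj_dn: "inj dn"
  by (auto simp: up_def dn_def inj_on_def)

lemma cc_bound: "\<bar>cc i\<bar> \<le> K"
  by (simp add: cc_def c_bound split: prod.split)

lemma index_simps: "up ((r, m), j) = ((r, m + 1), Suc j)" "dn ((r, m), j) = ((r, m - 1), Suc j)"
  "cc ((r, m), j) = c r j"
  by (simp_all add: up_def dn_def cc_def)

lemma not_in_range: "((r, m), 0) \<notin> range up" "((r, m), 0) \<notin> range dn"
  by (auto simp: up_def dn_def)

lemmas shift_image = Rep_basis_shift_image[where s = up and w = cc, OF inj_up cc_bound]
  Rep_basis_shift_image[where s = dn and w = cc, OF inj_dn cc_bound]
lemmas shift_outside =
  Rep_basis_shift_outside[where s = up and w = cc, OF inj_up cc_bound not_in_range(1)]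
  Rep_basis_shift_outside[where s = dn and w = cc, OF inj_dn cc_bound not_in_range(2)]
lemmas coshift = Rep_basis_coshift[where s = up and w = cc, OF inj_up cc_bound]
  Rep_basis_coshift[where s = dn and w = cc, OF inj_dn cc_bound]

lemma Rep_N_0: "Rep_ell2 (N x) ((r, m), 0) = complex_of_real (c r 0) * Rep_ell2 x ((r, m - 1), 1)"
  by (simp add: N_def plus_ell2.rep_eq shift_outside coshift index_simps)

lemma Rep_N_Suc: "Rep_ell2 (N x) ((r, m), Suc j) =
    complex_of_real (c r j) * Rep_ell2 x ((r, m - 1), j) +
    complex_of_real (c r (Suc j)) * Rep_ell2 x ((r, m - 1), Suc (Suc j))"
  using shift_image(1)[of x "((r, m - 1), j)"]
  by (simp add: N_def plus_ell2.rep_eq coshift index_simps)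

lemma Rep_N'_0: "Rep_ell2 (N' x) ((r, m), 0) = complex_of_real (c r 0) * Rep_ell2 x ((r, m + 1), 1)"
  by (simp add: N'_def plus_ell2.rep_eq shift_outside coshift index_simps)

lemma Rep_N'_Suc: "Rep_ell2 (N' x) ((r, m), Suc j) =
    complex_of_real (c r j) * Rep_ell2 x ((r, m + 1), j) +
    complex_of_real (c r (Suc j)) * Rep_ell2 x ((r, m + 1), Suc (Suc j))"
  using shift_image(2)[of x "((r, m + 1), j)"]
  by (simp add: N'_def plus_ell2.rep_eq coshift index_simps)

lemma N_N': "N (N' x) = N' (N x)"
proof (rule ell2_eqI)
  fix i :: "(nat \<times> int) \<times> nat"
  obtain r m j where i: "i = ((r, m), j)" by (cases i) auto
  consider "j = 0" | "j = 1" | k where "j = Suc (Suc k)" by (metis One_nat_def not0_implies_Suc)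
  then show "Rep_ell2 (N (N' x)) i = Rep_ell2 (N' (N x)) i"
    by cases (simp_all add: i Rep_N_0 Rep_N_Suc Rep_N'_0 Rep_N'_Suc)
qed

lemma bounded_clinear_N: "bounded_clinear N"
  unfolding N_def
  by (rule bounded_clinear_plus[OF bounded_clinear_basis_shift[where s = up and w = cc, OF inj_up cc_bound]
      bounded_clinear_basis_coshift[where s = dn and w = cc, OF inj_dn cc_bound]])

lemma cinner_N: "cinner (N x) y = cinner x (N' y)"
  by (simp add: N_def N'_def cinner_add_left cinner_add_right
      cinner_basis_shift[where s = up and w = cc, OF inj_up cc_bound] cinner_basis_coshift[where s = dn and w = cc, OF inj_dn cc_bound])

text \<open>
  The space of the row shifts is embedded by sending the basis vector at \<open>(r, n)\<close> to the bilateral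
  position \<open>n\<close> tensored with \<open>v r n\<close>.  These vectors are orthonormal because the positions differ,
  and the relation between \<open>w\<close>, \<open>c\<close> and \<open>v\<close> says that \<open>N\<close> acts on them as the shift.  A bijection
  between the two countable bases then moves the extension to \<^typ>\<open>nat ell2\<close>.
\<close>

lemma subnormal_row_shifts:
  fixes w :: "nat \<Rightarrow> nat \<Rightarrow> real" and v :: "nat \<Rightarrow> nat \<Rightarrow> nat \<Rightarrow> real"
  assumes w_bound: "\<And>r n. \<bar>w r n\<bar> \<le> B"
    and unit: "\<And>r n. (\<Sum>j\<le>n. (v r n j)\<^sup>2) = 1" and top: "\<And>r n j. n < j \<Longrightarrow> v r n j = 0"
    and step_0: "\<And>r n. w r n * v r (Suc n) 0 = c r 0 * v r n 1"
    and step_Suc: "\<And>r n j. w r n * v r (Suc n) (Suc j) =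
      c r j * v r n j + c r (Suc j) * v r n (Suc (Suc j))"
  shows "subnormal_op TYPE(nat ell2) (weighted_shift2_snd (\<lambda>(r, n). w r n))"
proof -
  define e :: "(nat \<times> nat) \<times> nat \<Rightarrow> (nat \<times> int) \<times> nat" where "e = (\<lambda>((r, n), j). ((r, int n), j))"
  define sh :: "nat \<times> nat \<Rightarrow> nat \<times> nat" where "sh = (\<lambda>(k1, k2). (k1, Suc k2))"
  define V :: "nat \<times> nat \<Rightarrow> nat \<Rightarrow> real" where "V = (\<lambda>(r, n). v r n)"
  define J where "J x = embed e (spread V x)" for x
  define T where "T = basis_shift sh (\<lambda>(r, n). w r n)"
  have sh: "inj sh" by (auto simp: sh_def inj_on_def)
  have bd: "\<bar>case i of (r, n) \<Rightarrow> w r n\<bar> \<le> B" for i by (simp add: w_bound split: prod.split)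
  have V: "((\<lambda>j. (V i j)\<^sup>2) has_sum 1) UNIV" for i
    by (rule has_sum_finite_neutralI[of "{..snd i}"])
      (auto simp: V_def unit top split: prod.split)
  have e: "inj e" by (auto simp: e_def inj_on_def)
  have "cisometry J"
    unfolding J_def by (rule cisometry_compose[OF cisometry_embed[OF e] cisometry_spread[where v = V, OF V]])
  have J_pos: "Rep_ell2 (J x) ((r, int n), j) = Rep_ell2 x (r, n) * complex_of_real (v r n j)"
    for x r n j
    using Rep_embed_image[OF e, of "spread V x" "((r, n), j)"]
    by (simp add: J_def Rep_spread[where v = V, OF V]) (simp add: e_def V_def)
  have J_neg: "Rep_ell2 (J x) ((r, m), j) = 0" if "m < 0" for x r m j
  proof -
    have "((r, m), j) \<notin> range e" using that by (auto simp: e_def)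
    then show ?thesis by (simp add: J_def Rep_embed[OF e])
  qed
  have T_0: "Rep_ell2 (T x) (r, 0) = 0" for x r
    unfolding T_def by (rule Rep_basis_shift_outside[where s = sh and w = "\<lambda>(r, n). w r n", OF sh bd]) (auto simp: sh_def)
  have T_Suc: "Rep_ell2 (T x) (r, Suc n) = complex_of_real (w r n) * Rep_ell2 x (r, n)" for x r n
    using Rep_basis_shift_image[where s = sh and w = "\<lambda>(r, n). w r n", OF sh bd, of x "(r, n)"] by (simp add: T_def sh_def)
  have step_0': "complex_of_real (c r 0) * complex_of_real (v r n (Suc 0)) =
      complex_of_real (w r n) * complex_of_real (v r (Suc n) 0)" for r n
    using step_0 by (simp flip: of_real_mult)
  have step_Suc': "complex_of_real (c r j) * complex_of_real (v r n j) +
      complex_of_real (c r (Suc j)) * complex_of_real (v r n (Suc (Suc j))) =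
      complex_of_real (w r n) * complex_of_real (v r (Suc n) (Suc j))" for r n j
    using step_Suc by (simp flip: of_real_mult of_real_add)
  have NJ: "N (J x) = J (T x)" for x
  proof (rule ell2_eqI)
    fix i :: "(nat \<times> int) \<times> nat"
    obtain r m j where i: "i = ((r, m), j)" by (cases i) auto
    consider "m < 0" | "m = int 0" | n where "m = int (Suc n)" 
    proof (cases m rule: int_cases)
      case (nonneg n)
      then show ?thesis using that(2,3) by (cases n) blast+
    next
      case (neg n)
      then show ?thesis using that(1) by simp
    qed
    then show "Rep_ell2 (N (J x)) i = Rep_ell2 (J (T x)) i"
    proof cases
      case 1
      then show ?thesis by (cases j) (simp_all add: i Rep_N_0 Rep_N_Suc J_neg)
    next
      case 2
      then show ?thesis
        unfolding i 2 J_pos T_0 by (cases j) (simp_all add: Rep_N_0 Rep_N_Suc J_neg)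
    next
      case (3 n)
      have m: "m - 1 = int n" using 3 by simp
      show ?thesis
      proof (cases j)
        case 0
        have "Rep_ell2 (N (J x)) i = Rep_ell2 x (r, n) *
            (complex_of_real (c r 0) * complex_of_real (v r n (Suc 0)))"
          by (simp add: i 0 Rep_N_0 m J_pos mult_ac)
        then show ?thesis unfolding i 0 step_0' 3 J_pos T_Suc by (simp add: mult_ac)
      next
        case (Suc k)
        have "Rep_ell2 (N (J x)) i = Rep_ell2 x (r, n) *
            (complex_of_real (c r k) * complex_of_real (v r n k) +
             complex_of_real (c r (Suc k)) * complex_of_real (v r n (Suc (Suc k))))"
          by (simp add: i Suc Rep_N_Suc m J_pos algebra_simps)
        then show ?thesis unfolding i Suc step_Suc' 3 J_pos T_Suc by (simp add: mult_ac)
      qed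
    qed
  qed
  define \<phi> :: "(nat \<times> int) \<times> nat \<Rightarrow> nat" where "\<phi> = to_nat_on UNIV"
  have \<phi>: "bij \<phi>"
    unfolding \<phi>_def by (rule to_nat_on_infinite) (auto simp: finite_prod)
  define U where "U = embed \<phi>"
  define U' where "U' = embed (inv \<phi>)"
  have inv: "U (U' x) = x" "U' (U y) = y" for x y
    using embed_inverse[OF \<phi>] embed_inverse[OF bij_imp_bij_inv[OF \<phi>]] \<phi>
    by (auto simp: U_def U'_def inv_inv_eq)
  have U: "cisometry U" "cisometry U'"
    unfolding U_def U'_def using \<phi> by (auto intro!: cisometry_embed simp: bij_is_inj bij_imp_bij_inv)
  have "normal_op (\<lambda>x. U (N (U' x)))"
    by (rule normal_op_unitary[OF U inv bounded_clinear_N cinner_N N_N'])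
  moreover have "cisometry (\<lambda>x. U (J x))" by (rule cisometry_compose[OF U(1) \<open>cisometry J\<close>])
  moreover have "U (N (U' (U (J x)))) = U (J (T x))" for x by (simp add: inv NJ)
  moreover have "bounded_clinear T"
    unfolding T_def by (rule bounded_clinear_basis_shift[where s = sh and w = "\<lambda>(r, n). w r n", OF sh bd])
  ultimately have "subnormal_op TYPE(nat ell2) T" unfolding subnormal_op_def by blast
  then show ?thesis by (simp add: T_def weighted_shift2_snd_def sh_def)
qed

end

section \<open>Berger measures\<close>

text \<open>
  The probability measure \<open>\<kappa> \<delta>\<^sub>0 + g d\<sigma>\<close> on \<open>{0..B}\<close>.  The atom is kept apart so that no new measure
  has to be constructed.
\<close>

locale compact_density =
  fixes \<sigma> :: "real measure" and g :: "real \<Rightarrow> real" and \<kappa> B :: real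
  assumes sets_eq: "sets \<sigma> = sets borel"
    and support: "AE t in \<sigma>. 0 \<le> t \<and> t \<le> B"
    and g_integrable: "integrable \<sigma> g" and g_nonneg: "AE t in \<sigma>. 0 \<le> g t"
    and \<kappa>_nonneg: "0 \<le> \<kappa>" and B_nonneg: "0 \<le> B" and mass: "\<kappa> + (\<integral>t. g t \<partial>\<sigma>) = 1"
begin

text \<open>
  Averaging over the two square roots of \<open>t\<close> integrates \<open>p\<close> against the symmetric measure whose image
  under squaring is the given one.
\<close>

definition ev :: "real poly \<Rightarrow> real \<Rightarrow> real" where
  "ev p t = (poly p (sqrt t) + poly p (- sqrt t)) / 2"

definition L :: "real poly \<Rightarrow> real" where
  "L p = \<kappa> * poly p 0 + (\<integral>t. g t * ev p t \<partial>\<sigma>)"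

lemma integrable_ev: "integrable \<sigma> (\<lambda>t. g t * ev p t)"
proof -
  have cont: "continuous_on UNIV (ev p)"
    unfolding ev_def by (intro continuous_intros) auto
  have "compact (ev p ` {0..B})"
    by (intro compact_continuous_image continuous_on_subset[OF cont]) auto
  then obtain M where "\<forall>t\<in>{0..B}. \<bar>ev p t\<bar> \<le> M"
    by (auto simp: bounded_iff dest!: compact_imp_bounded)
  then have M: "\<bar>ev p t\<bar> \<le> M" if "0 \<le> t" "t \<le> B" for t using that by simp
  have "ev p \<in> borel_measurable \<sigma>"
    using borel_measurable_continuous_onI[OF cont] measurable_cong_sets[OF sets_eq refl] by blast
  then have meas: "(\<lambda>t. g t * ev p t) \<in> borel_measurable \<sigma>"
    using g_integrable by (intro borel_measurable_times) auto
  show ?thesis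
  proof (rule Bochner_Integration.integrable_bound[OF _ meas])
    show "integrable \<sigma> (\<lambda>t. M * g t)" using g_integrable by simp
    show "AE t in \<sigma>. norm (g t * ev p t) \<le> norm (M * g t)"
      using support
    proof eventually_elim
      case (elim t)
      then have "\<bar>ev p t\<bar> \<le> \<bar>M\<bar>" using M[of t] by linarith
      then have "\<bar>g t\<bar> * \<bar>ev p t\<bar> \<le> \<bar>g t\<bar> * \<bar>M\<bar>" by (rule mult_left_mono) simp
      then show ?case by (simp add: abs_mult mult.commute)
    qed
  qed
qed

lemma ev_square: "ev (p * p) t = ((poly p (sqrt t))\<^sup>2 + (poly p (- sqrt t))\<^sup>2) / 2"
  by (simp add: ev_def power2_eq_square)

lemma ev_monom: "0 \<le> t \<Longrightarrow> ev (monom 1 (2 * n)) t = t ^ n"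
  by (simp add: ev_def poly_monom power_mult)

sublocale symmetric_functional L B
proof
  fix p q :: "real poly" and r :: real
  have "(\<integral>t. g t * ev (p + q) t \<partial>\<sigma>) = (\<integral>t. g t * ev p t + g t * ev q t \<partial>\<sigma>)"
    by (rule arg_cong[where f = "integral\<^sup>L \<sigma>"]) (auto simp: ev_def field_simps)
  also have "\<dots> = (\<integral>t. g t * ev p t \<partial>\<sigma>) + (\<integral>t. g t * ev q t \<partial>\<sigma>)"
    by (intro Bochner_Integration.integral_add integrable_ev)
  finally show "L (p + q) = L p + L q" by (simp add: L_def algebra_simps)
  have "(\<integral>t. g t * ev (smult r p) t \<partial>\<sigma>) = (\<integral>t. r * (g t * ev p t) \<partial>\<sigma>)"
    by (rule arg_cong[where f = "integral\<^sup>L \<sigma>"]) (auto simp: ev_def field_simps)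
  then show "L (smult r p) = r * L p" by (simp add: L_def algebra_simps)
  have "0 \<le> (\<integral>t. g t * ev (p * p) t \<partial>\<sigma>)"
    using g_nonneg by (intro integral_nonneg_AE) (auto simp: ev_square)
  then show "0 \<le> L (p * p)" using \<kappa>_nonneg by (simp add: L_def)
  show "L (pcompose p [:0, -1:]) = L p"
    by (simp add: L_def ev_def poly_pcompose add.commute)
  have "(\<integral>t. g t * ev (pCons 0 p * pCons 0 p) t \<partial>\<sigma>) \<le> (\<integral>t. B * (g t * ev (p * p) t) \<partial>\<sigma>)"
  proof (rule integral_mono_AE)
    show "integrable \<sigma> (\<lambda>t. g t * ev (pCons 0 p * pCons 0 p) t)" by (rule integrable_ev)
    show "integrable \<sigma> (\<lambda>t. B * (g t * ev (p * p) t))" using integrable_ev by simp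
    show "AE t in \<sigma>. g t * ev (pCons 0 p * pCons 0 p) t \<le> B * (g t * ev (p * p) t)"
      using support g_nonneg
    proof eventually_elim
      case (elim t)
      then have "ev (pCons 0 p * pCons 0 p) t = t * ev (p * p) t"
        unfolding ev_square by (simp add: power_mult_distrib field_simps)
      moreover have "t * (g t * ev (p * p) t) \<le> B * (g t * ev (p * p) t)"
        using elim by (intro mult_right_mono mult_nonneg_nonneg) (auto simp: ev_square)
      ultimately show ?case by (simp add: mult_ac)
    qed
  qed
  moreover have "0 \<le> B * \<kappa> * (poly p 0)\<^sup>2" using B_nonneg \<kappa>_nonneg by simp
  ultimately show "L (pCons 0 p * pCons 0 p) \<le> B * L (p * p)"
    by (simp add: L_def power2_eq_square algebra_simps)
  show "L 1 = 1" using mass by (simp add: L_def ev_def)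
qed

lemma L_monom: "L (monom 1 (2 * Suc n)) = (\<integral>t. g t * t ^ Suc n \<partial>\<sigma>)"
proof -
  have "(\<integral>t. g t * ev (monom 1 (2 * Suc n)) t \<partial>\<sigma>) = (\<integral>t. g t * t ^ Suc n \<partial>\<sigma>)"
  proof (rule integral_cong_AE)
    show "(\<lambda>t. g t * ev (monom 1 (2 * Suc n)) t) \<in> borel_measurable \<sigma>"
      using integrable_ev by blast
    have "(\<lambda>t. t ^ Suc n) \<in> borel_measurable \<sigma>"
      unfolding measurable_cong_sets[OF sets_eq refl] by measurable
    then show "(\<lambda>t. g t * t ^ Suc n) \<in> borel_measurable \<sigma>"
      using g_integrable by (intro borel_measurable_times) auto
    show "AE t in \<sigma>. g t * ev (monom 1 (2 * Suc n)) t = g t * t ^ Suc n"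
      using support by eventually_elim (simp only: ev_monom)
  qed
  then show ?thesis by (simp add: L_def poly_monom)
qed

end

lemma Berger_measure_support:
  assumes "Berger_measure \<alpha> \<mu>"
  shows "AE t in \<mu>. 0 \<le> t \<and> t \<le> (onorm (weighted_shift \<alpha>))\<^sup>2"
proof -
  interpret prob_space \<mu> using assms by (simp add: Berger_measure_def)
  have "AE t in \<mu>. t \<in> {0..(onorm (weighted_shift \<alpha>))\<^sup>2}"
    using assms by (intro AE_prob_1) (simp add: Berger_measure_def)
  then show ?thesis by simp
qed

lemma Berger_measure_moment:
  assumes "Berger_measure \<alpha> \<mu>"
  shows "(\<integral>t. t ^ n \<partial>\<mu>) = (\<Prod>i<n. (\<alpha> i)\<^sup>2)"
proof (cases "n = 0")
  case True
  interpret prob_space \<mu> using assms by (simp add: Berger_measure_def)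
  show ?thesis by (simp add: True prob_space)
next
  case False
  then have "1 \<le> n" by simp
  then show ?thesis using assms unfolding Berger_measure_def by presburger
qed

lemma Berger_measure_density:
  assumes "Berger_measure \<alpha> \<mu>"
  shows "compact_density \<mu> (\<lambda>_. 1) 0 ((onorm (weighted_shift \<alpha>))\<^sup>2)"
proof -
  interpret prob_space \<mu> using assms by (simp add: Berger_measure_def)
  show ?thesis
    using assms Berger_measure_support[OF assms]
    by unfold_locales (auto simp: Berger_measure_def prob_space)
qed

text \<open>
  The mass of \<open>(a\<^sup>2/t) d\<mu>\<close> is at most 1 and the rest is put at 0, where it does not change the
  moments of positive order.  This yields the measure of the shift that has one more weight \<open>a\<close> in
  front.
\<close>

lemma Berger_measure_backward_density:
  assumes \<mu>: "Berger_measure \<alpha> \<mu>" and int: "integrable \<mu> (\<lambda>t. 1 / t)"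
    and le: "a\<^sup>2 * (\<integral>t. 1 / t \<partial>\<mu>) \<le> 1"
  shows "compact_density \<mu> (\<lambda>t. a\<^sup>2 / t) (1 - a\<^sup>2 * (\<integral>t. 1 / t \<partial>\<mu>)) ((onorm (weighted_shift \<alpha>))\<^sup>2)"
proof
  show "sets \<mu> = sets borel" using \<mu> by (simp add: Berger_measure_def)
  show "AE t in \<mu>. 0 \<le> t \<and> t \<le> (onorm (weighted_shift \<alpha>))\<^sup>2"
    by (rule Berger_measure_support[OF \<mu>])
  then show "AE t in \<mu>. 0 \<le> a\<^sup>2 / t" by eventually_elim simp
  have "integrable \<mu> (\<lambda>t. a\<^sup>2 * (1 / t))" using int by (rule integrable_mult_right)
  then show "integrable \<mu> (\<lambda>t. a\<^sup>2 / t)" by simp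
  have "(\<integral>t. a\<^sup>2 * (1 / t) \<partial>\<mu>) = a\<^sup>2 * (\<integral>t. 1 / t \<partial>\<mu>)" by (rule integral_mult_right_zero)
  then show "1 - a\<^sup>2 * (\<integral>t. 1 / t \<partial>\<mu>) + (\<integral>t. a\<^sup>2 / t \<partial>\<mu>) = 1" by simp
qed (use le in auto)

lemma integral_backward_moment:
  fixes \<mu> :: "real measure"
  assumes nz: "AE t in \<mu>. t \<noteq> 0" and sets: "sets \<mu> = sets borel"
  shows "(\<integral>t. a\<^sup>2 / t * t ^ Suc n \<partial>\<mu>) = a\<^sup>2 * (\<integral>t. t ^ n \<partial>\<mu>)"
proof -
  have "(\<integral>t. a\<^sup>2 / t * t ^ Suc n \<partial>\<mu>) = (\<integral>t. a\<^sup>2 * t ^ n \<partial>\<mu>)"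
  proof (rule integral_cong_AE)
    show "(\<lambda>t. a\<^sup>2 / t * t ^ Suc n) \<in> borel_measurable \<mu>"
      unfolding measurable_cong_sets[OF sets refl] by measurable
    show "(\<lambda>t. a\<^sup>2 * t ^ n) \<in> borel_measurable \<mu>"
      unfolding measurable_cong_sets[OF sets refl] by measurable
    show "AE t in \<mu>. a\<^sup>2 / t * t ^ Suc n = a\<^sup>2 * t ^ n"
      using nz by eventually_elim simp
  qed
  then show ?thesis by simp
qed

lemma extremal_pos:
  assumes "0 < extremal \<mu>" "AE t in \<mu>. 0 \<le> t"
  shows "AE t in \<mu>. t \<noteq> 0" "integrable \<mu> (\<lambda>t. 1 / t)"
    "(extremal \<mu>)\<^sup>2 * (\<integral>t. 1 / t \<partial>\<mu>) = 1"
proof -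
  let ?R = "\<integral>t. 1 / t \<partial>\<mu>"
  show *: "AE t in \<mu>. t \<noteq> 0" "integrable \<mu> (\<lambda>t. 1 / t)"
    using assms by (auto simp: extremal_def split: if_splits)
  have ext: "extremal \<mu> = ?R powr (- 1 / 2)" using * by (simp add: extremal_def)
  have "0 \<le> ?R" using assms(2) by (intro integral_nonneg_AE) (auto elim: eventually_mono)
  moreover have "?R \<noteq> 0" using assms ext by auto
  ultimately have R: "0 < ?R" by simp
  have "(extremal \<mu>)\<^sup>2 = ?R powr (- 1)"
    unfolding ext power2_eq_square by (simp flip: powr_add)
  then show "(extremal \<mu>)\<^sup>2 * ?R = 1" using R by (simp add: powr_minus)
qed

lemma tangent_of_reciprocal:
  fixes t y :: real
  assumes "0 < t" "0 < y"
  shows "2 / y - t / y\<^sup>2 \<le> 1 / t"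
proof -
  have "0 \<le> (t - y)\<^sup>2 / (t * y\<^sup>2)" using assms by simp
  also have "\<dots> = 1 / t - (2 / y - t / y\<^sup>2)"
    using assms by (simp add: power2_eq_square field_simps)
  finally show ?thesis by simp
qed

text \<open>
  Jensen's inequality \<open>1 / \<integral>t d\<mu> \<le> \<integral>1/t d\<mu>\<close>, by integrating the tangent to \<open>1/t\<close> at the mean.
\<close>

lemma extremal_square_le_mean:
  assumes \<mu>: "Berger_measure \<alpha> \<mu>" and pos: "0 < \<alpha> 0"
  shows "(extremal \<mu>)\<^sup>2 \<le> (\<alpha> 0)\<^sup>2"
proof (cases "0 < extremal \<mu>")
  case True
  interpret prob_space \<mu> using \<mu> by (simp add: Berger_measure_def)
  let ?Y = "(\<alpha> 0)\<^sup>2" and ?R = "\<integral>t. 1 / t \<partial>\<mu>"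
  have Y: "0 < ?Y" using pos by simp
  have supp: "AE t in \<mu>. 0 \<le> t \<and> t \<le> (onorm (weighted_shift \<alpha>))\<^sup>2"
    by (rule Berger_measure_support[OF \<mu>])
  then have supp0: "AE t in \<mu>. 0 \<le> t" by (auto elim: eventually_mono)
  note ext = extremal_pos[OF True supp0]
  have mean: "(\<integral>t. t \<partial>\<mu>) = ?Y"
    using Berger_measure_moment[OF \<mu>, of 1] by simp
  \<comment> \<open>A function that is not integrable has integral 0, but this integral is positive.\<close>
  have intid: "integrable \<mu> (\<lambda>t. t)"
    using mean Y not_integrable_integral_eq[of \<mu> "\<lambda>t. t"] by fastforce
  have "(\<integral>t. 2 / ?Y - t / ?Y\<^sup>2 \<partial>\<mu>) \<le> ?R"
  proof (rule integral_mono_AE)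
    show "integrable \<mu> (\<lambda>t. 2 / ?Y - t / ?Y\<^sup>2)" using intid by simp
    show "integrable \<mu> (\<lambda>t. 1 / t)" by (rule ext)
    show "AE t in \<mu>. 2 / ?Y - t / ?Y\<^sup>2 \<le> 1 / t"
      using ext(1) supp0
      by eventually_elim (rule tangent_of_reciprocal, use Y in auto)
  qed
  moreover have "(\<integral>t. 2 / ?Y - t / ?Y\<^sup>2 \<partial>\<mu>) = 1 / ?Y"
    using intid mean Y by (simp add: prob_space power2_eq_square field_simps)
  ultimately have "1 / ?Y \<le> ?R" by simp
  then have "(extremal \<mu>)\<^sup>2 * (1 / ?Y) \<le> 1"
    using ext(3) by (metis mult_left_mono zero_le_power2)
  then show ?thesis using Y by (simp add: field_simps)
next
  case False
  have "0 \<le> extremal \<mu>" by (simp add: extremal_def)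
  then show ?thesis using False by simp
qed

text \<open>
  Row 0 carries the weights \<open>a, \<xi> 1, \<xi> 2, \<dots>\<close>, modelled by the backward extension of \<open>\<nu>\<^sub>M\<close>, and all
  other rows carry \<open>\<xi>\<close>, modelled by \<open>\<nu>\<close>.
\<close>

lemma subnormal_perturbed_rows:
  fixes \<xi> :: "nat \<Rightarrow> real"
  assumes bdd: "bounded (range \<xi>)" and pos: "\<And>k. 0 < \<xi> k"
    and \<nu>: "Berger_measure \<xi> \<nu>" and \<nu>M: "Berger_measure (\<lambda>k. \<xi> (k + 1)) \<nu>\<^sub>M"
    and a: "0 < a" "a \<le> extremal \<nu>\<^sub>M"
  shows "subnormal_op TYPE(nat ell2)
    (weighted_shift2_snd (\<lambda>(k1, k2). if k1 \<ge> 1 \<or> k2 \<ge> 1 then \<xi> k2 else a))"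
proof -
  let ?R = "\<integral>t. 1 / t \<partial>\<nu>\<^sub>M"
  define \<xi>' where "\<xi>' n = (if n \<ge> 1 then \<xi> n else a)" for n :: nat
  have \<xi>': "0 < \<xi>' n" for n using pos a by (simp add: \<xi>'_def)
  interpret nu: compact_density \<nu> "\<lambda>_. 1" 0 "(onorm (weighted_shift \<xi>))\<^sup>2"
    by (rule Berger_measure_density[OF \<nu>])
  have "0 < extremal \<nu>\<^sub>M" using a by simp
  moreover have "AE t in \<nu>\<^sub>M. 0 \<le> t"
    using Berger_measure_support[OF \<nu>M] by (auto elim: eventually_mono)
  ultimately have ext: "AE t in \<nu>\<^sub>M. t \<noteq> 0" "integrable \<nu>\<^sub>M (\<lambda>t. 1 / t)"
    "(extremal \<nu>\<^sub>M)\<^sup>2 * ?R = 1"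
    by (rule extremal_pos)+
  have "0 < (extremal \<nu>\<^sub>M)\<^sup>2" using a by simp
  with ext(3) have "0 < ?R" by (metis mult_less_0_iff not_less_iff_gr_or_eq zero_less_mult_pos zero_less_one)
  then have "a\<^sup>2 * ?R \<le> (extremal \<nu>\<^sub>M)\<^sup>2 * ?R"
    using a by (intro mult_right_mono power_mono) auto
  then have le: "a\<^sup>2 * ?R \<le> 1" using ext(3) by simp
  interpret mu: compact_density \<nu>\<^sub>M "\<lambda>t. a\<^sup>2 / t" "1 - a\<^sup>2 * ?R"
    "(onorm (weighted_shift (\<lambda>k. \<xi> (k + 1))))\<^sup>2"
    by (rule Berger_measure_backward_density[OF \<nu>M ext(2) le])
  have mom_nu: "nu.L (monom 1 (2 * n)) = (\<Prod>i<n. (\<xi> i)\<^sup>2)" for n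
  proof (cases n)
    case 0
    then show ?thesis using nu.one by simp
  next
    case (Suc m)
    show ?thesis
      unfolding Suc nu.L_monom using Berger_measure_moment[OF \<nu>, of "Suc m"] by simp
  qed
  have mom_mu: "mu.L (monom 1 (2 * n)) = (\<Prod>i<n. (\<xi>' i)\<^sup>2)" for n
  proof (cases n)
    case 0
    then show ?thesis using mu.one by simp
  next
    case (Suc m)
    have "mu.L (monom 1 (2 * n)) = a\<^sup>2 * (\<Prod>i<m. (\<xi> (i + 1))\<^sup>2)"
      unfolding Suc mu.L_monom integral_backward_moment[OF ext(1) mu.sets_eq]
      by (simp add: Berger_measure_moment[OF \<nu>M])
    also have "\<dots> = (\<Prod>i<n. (\<xi>' i)\<^sup>2)"
      unfolding Suc by (simp add: prod.lessThan_Suc_shift \<xi>'_def del: prod.lessThan_Suc)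
    finally show ?thesis .
  qed
  obtain c0 v0 where 0: "\<And>j. \<bar>c0 j\<bar> \<le> sqrt ((onorm (weighted_shift (\<lambda>k. \<xi> (k + 1))))\<^sup>2)"
    "\<And>n. (\<Sum>j\<le>n. (v0 n j)\<^sup>2) = 1" "\<And>n j. n < j \<Longrightarrow> v0 n j = 0"
    "\<And>n. \<xi>' n * v0 (Suc n) 0 = c0 0 * v0 n 1"
    "\<And>n j. \<xi>' n * v0 (Suc n) (Suc j) = c0 j * v0 n j + c0 (Suc j) * v0 n (Suc (Suc j))"
    using mu.ex_jacobi_model[OF \<xi>' mom_mu] by blast
  obtain c1 v1 where 1: "\<And>j. \<bar>c1 j\<bar> \<le> sqrt ((onorm (weighted_shift \<xi>))\<^sup>2)"
    "\<And>n. (\<Sum>j\<le>n. (v1 n j)\<^sup>2) = 1" "\<And>n j. n < j \<Longrightarrow> v1 n j = 0"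
    "\<And>n. \<xi> n * v1 (Suc n) 0 = c1 0 * v1 n 1"
    "\<And>n j. \<xi> n * v1 (Suc n) (Suc j) = c1 j * v1 n j + c1 (Suc j) * v1 n (Suc (Suc j))"
    using nu.ex_jacobi_model[OF pos mom_nu] by blast
  obtain M where M: "\<And>k. \<bar>\<xi> k\<bar> \<le> M"
    using bdd by (auto simp: bounded_iff)
  let ?K = "max (sqrt ((onorm (weighted_shift (\<lambda>k. \<xi> (k + 1))))\<^sup>2))
    (sqrt ((onorm (weighted_shift \<xi>))\<^sup>2))"
  interpret jacobi_rows "\<lambda>r. if r = 0 then c0 else c1" ?K
    by unfold_locales (use 0(1) 1(1) in \<open>auto simp: le_max_iff_disj\<close>)
  have "subnormal_op TYPE(nat ell2) (weighted_shift2_snd (\<lambda>(r, n). (if r = 0 then \<xi>' else \<xi>) n))"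
  proof (rule subnormal_row_shifts[where v = "\<lambda>r. if r = 0 then v0 else v1"])
    show "\<bar>(if r = 0 then \<xi>' else \<xi>) n\<bar> \<le> max M a" for r n :: nat
      using M[of n] a by (auto simp: \<xi>'_def le_max_iff_disj)
  qed (use 0 1 in auto)
  also have "(\<lambda>(r::nat, n). (if r = 0 then \<xi>' else \<xi>) n) =
      (\<lambda>(k1, k2). if k1 \<ge> 1 \<or> k2 \<ge> 1 then \<xi> k2 else a)"
    by (auto simp: \<xi>'_def fun_eq_iff)
  finally show ?thesis .
qed

section \<open>Two-variable weighted shifts perturbed at the origin\<close>

lemma inj_steps: "inj (\<lambda>(k1, k2). (Suc k1, k2))" "inj (\<lambda>(k1, k2). (k1, Suc k2))"
  by (auto simp: inj_on_def)

locale bounded_weights2 =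
  fixes \<alpha> \<beta> :: "nat \<times> nat \<Rightarrow> real" and K :: real
  assumes \<alpha>_bound: "\<bar>\<alpha> k\<bar> \<le> K" and \<beta>_bound: "\<bar>\<beta> k\<bar> \<le> K"
begin

definition T1 where "T1 = weighted_shift2_fst \<alpha>"
definition T2 where "T2 = weighted_shift2_snd \<beta>"
definition T1' where "T1' = basis_coshift (\<lambda>(k1, k2). (Suc k1, k2)) \<alpha>"
definition T2' where "T2' = basis_coshift (\<lambda>(k1, k2). (k1, Suc k2)) \<beta>"

lemmas shift1 = Rep_basis_shift_image[where w = \<alpha>, OF inj_steps(1) \<alpha>_bound]
lemmas shift2 = Rep_basis_shift_image[where w = \<beta>, OF inj_steps(2) \<beta>_bound]

lemma Rep_T1: "Rep_ell2 (T1 x) (0, n) = 0"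
  "Rep_ell2 (T1 x) (Suc m, n) = complex_of_real (\<alpha> (m, n)) * Rep_ell2 x (m, n)"
proof -
  show "Rep_ell2 (T1 x) (0, n) = 0"
    unfolding T1_def weighted_shift2_fst_def
    by (rule Rep_basis_shift_outside[where w = \<alpha>, OF inj_steps(1) \<alpha>_bound]) auto
  show "Rep_ell2 (T1 x) (Suc m, n) = complex_of_real (\<alpha> (m, n)) * Rep_ell2 x (m, n)"
    using shift1[of x "(m, n)"] by (simp add: T1_def weighted_shift2_fst_def)
qed

lemma Rep_T2: "Rep_ell2 (T2 x) (m, 0) = 0"
  "Rep_ell2 (T2 x) (m, Suc n) = complex_of_real (\<beta> (m, n)) * Rep_ell2 x (m, n)"
proof -
  show "Rep_ell2 (T2 x) (m, 0) = 0"
    unfolding T2_def weighted_shift2_snd_def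
    by (rule Rep_basis_shift_outside[where w = \<beta>, OF inj_steps(2) \<beta>_bound]) auto
  show "Rep_ell2 (T2 x) (m, Suc n) = complex_of_real (\<beta> (m, n)) * Rep_ell2 x (m, n)"
    using shift2[of x "(m, n)"] by (simp add: T2_def weighted_shift2_snd_def)
qed

lemma Rep_T1': "Rep_ell2 (T1' x) (m, n) = complex_of_real (\<alpha> (m, n)) * Rep_ell2 x (Suc m, n)"
  by (simp add: T1'_def Rep_basis_coshift[where w = \<alpha>, OF inj_steps(1) \<alpha>_bound])

lemma Rep_T2': "Rep_ell2 (T2' x) (m, n) = complex_of_real (\<beta> (m, n)) * Rep_ell2 x (m, Suc n)"
  by (simp add: T2'_def Rep_basis_coshift[where w = \<beta>, OF inj_steps(2) \<beta>_bound])

lemma bounded_clinear_T: "bounded_clinear T1" "bounded_clinear T2"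
  unfolding T1_def T2_def weighted_shift2_fst_def weighted_shift2_snd_def
  by (rule bounded_clinear_basis_shift[where w = \<alpha>, OF inj_steps(1) \<alpha>_bound]
      bounded_clinear_basis_shift[where w = \<beta>, OF inj_steps(2) \<beta>_bound])+

lemma cadjoint_T: "cadjoint T1 = T1'" "cadjoint T2 = T2'"
  unfolding T1_def T2_def T1'_def T2'_def weighted_shift2_fst_def weighted_shift2_snd_def
  by (rule cadjoint_eqI cinner_basis_shift[where w = \<alpha>, OF inj_steps(1) \<alpha>_bound]
      cinner_basis_shift[where w = \<beta>, OF inj_steps(2) \<beta>_bound])+

lemma T_basis:
  "T1 (ell2_basis (m, n)) = \<alpha> (m, n) *\<^sub>R ell2_basis (Suc m, n)"
  "T2 (ell2_basis (m, n)) = \<beta> (m, n) *\<^sub>R ell2_basis (m, Suc n)"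
  using basis_shift_ell2_basis[where w = \<alpha>, OF inj_steps(1) \<alpha>_bound, of "(m, n)"]
    basis_shift_ell2_basis[where w = \<beta>, OF inj_steps(2) \<beta>_bound, of "(m, n)"]
  by (simp_all add: T1_def T2_def weighted_shift2_fst_def weighted_shift2_snd_def scaleC_of_real)

lemma commute:
  assumes "\<And>m n. \<alpha> (m, Suc n) * \<beta> (m, n) = \<beta> (Suc m, n) * \<alpha> (m, n)"
  shows "T1 \<circ> T2 = T2 \<circ> T1"
proof (rule ext, rule ell2_eqI)
  fix x and k :: "nat \<times> nat"
  have *: "complex_of_real (\<alpha> (m, Suc n)) * (complex_of_real (\<beta> (m, n)) * z) =
      complex_of_real (\<beta> (Suc m, n)) * (complex_of_real (\<alpha> (m, n)) * z)" for m n z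
    using arg_cong[OF assms[of m n], of complex_of_real] by (simp flip: mult.assoc)
  obtain m n where k: "k = (m, n)" by (cases k)
  show "Rep_ell2 ((T1 \<circ> T2) x) k = Rep_ell2 ((T2 \<circ> T1) x) k"
    unfolding k by (cases m; cases n) (simp_all add: Rep_T1 Rep_T2 *)
qed

end

text \<open>
  Exchanging the coordinates reduces the first operator to the row shifts treated above.
\<close>

lemma (in bounded_weights2) swap_intertwines:
  assumes "\<And>m n. \<beta> (m, n) = \<alpha> (n, m)"
  shows "T2 (embed prod.swap x) = embed prod.swap (T1 x)"
proof (rule ell2_eqI)
  fix k :: "nat \<times> nat"
  obtain m n where k: "k = (m, n)" by (cases k)
  have sw: "Rep_ell2 (embed prod.swap z) (i, j) = Rep_ell2 z (j, i)" for z :: "(nat \<times> nat) ell2" and i j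
    using Rep_embed_image[OF inj_swap, of z "(j, i)"] by simp
  show "Rep_ell2 (T2 (embed prod.swap x)) k = Rep_ell2 (embed prod.swap (T1 x)) k"
    unfolding k by (cases n) (simp_all add: sw Rep_T1 Rep_T2 assms)
qed

lemma cinner_single:
  assumes "\<And>k. Rep_ell2 z k = (if k = i then c else 0)"
  shows "cinner z x = c * cnj (Rep_ell2 x i)"
proof -
  have "cinner z x = (\<Sum>\<^sub>\<infinity>k\<in>{i}. Rep_ell2 z k * cnj (Rep_ell2 x k))"
    unfolding cinner_ell2 by (rule infsum_cong_neutral) (auto simp: assms)
  then show ?thesis by (simp add: assms)
qed

lemma norm_ell2_basis: "norm (ell2_basis i) = 1"
proof -
  have "cinner (ell2_basis i) (ell2_basis i) = 1"
    using cinner_single[of "ell2_basis i" i 1 "ell2_basis i"] by (simp add: ell2_basis.rep_eq)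
  then show ?thesis by (simp add: norm_eq_sqrt_inner flip: Re_cinner)
qed

text \<open>
  A single diagonal entry already bounds the quadratic form below, which is all that is needed when
  the off-diagonal part involves one entry of each vector.
\<close>

lemma cinner_diagonal:
  assumes z: "\<And>k. Rep_ell2 z k = complex_of_real (d k) * Rep_ell2 x k" and d: "\<And>k. 0 \<le> d k"
  shows "Im (cinner z x) = 0" and "d i * (cmod (Rep_ell2 x i))\<^sup>2 \<le> Re (cinner z x)"
proof -
  have eq: "Rep_ell2 z k * cnj (Rep_ell2 x k) = complex_of_real (d k * (cmod (Rep_ell2 x k))\<^sup>2)" for k
    by (simp add: z complex_norm_square mult.assoc del: of_real_power)
  have sm: "(\<lambda>k. Rep_ell2 z k * cnj (Rep_ell2 x k)) summable_on UNIV"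
    by (rule summable_mult_cnj[OF square_summable_Rep_ell2 square_summable_Rep_ell2])
  have smr: "(\<lambda>k. d k * (cmod (Rep_ell2 x k))\<^sup>2) summable_on UNIV"
    using summable_on_Re[OF sm] unfolding eq Re_complex_of_real .
  then have "(\<Sum>\<^sub>\<infinity>k. Rep_ell2 z k * cnj (Rep_ell2 x k)) =
      complex_of_real (\<Sum>\<^sub>\<infinity>k. d k * (cmod (Rep_ell2 x k))\<^sup>2)"
    unfolding eq by (intro infsumI has_sum_of_real has_sum_infsum)
  then have c: "cinner z x = complex_of_real (\<Sum>\<^sub>\<infinity>k. d k * (cmod (Rep_ell2 x k))\<^sup>2)"
    by (simp add: cinner_ell2)
  show "Im (cinner z x) = 0" by (simp add: c)
  have "(\<Sum>k\<in>{i}. d k * (cmod (Rep_ell2 x k))\<^sup>2) \<le> (\<Sum>\<^sub>\<infinity>k. d k * (cmod (Rep_ell2 x k))\<^sup>2)"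
    by (rule finite_sum_le_infsum[OF smr]) (auto simp: d)
  then show "d i * (cmod (Rep_ell2 x i))\<^sup>2 \<le> Re (cinner z x)" by (simp add: c)
qed

lemma two_by_two_form_nonneg:
  fixes p q \<kappa> :: real and z w :: complex
  assumes "0 \<le> p" "0 \<le> q" "\<kappa>\<^sup>2 \<le> p * q"
  shows "0 \<le> p * (cmod z)\<^sup>2 + q * (cmod w)\<^sup>2 + 2 * \<kappa> * Re (w * cnj z)"
proof -
  have "\<bar>\<kappa>\<bar> \<le> sqrt p * sqrt q"
    using real_sqrt_le_mono[OF assms(3)] by (simp add: real_sqrt_mult)
  moreover have "\<bar>Re (w * cnj z)\<bar> \<le> cmod w * cmod z"
    using abs_Re_le_cmod[of "w * cnj z"] by (simp add: norm_mult)
  ultimately have "\<bar>\<kappa>\<bar> * \<bar>Re (w * cnj z)\<bar> \<le> (sqrt p * sqrt q) * (cmod w * cmod z)"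
    by (intro mult_mono) (use assms in auto)
  moreover have "- (\<kappa> * Re (w * cnj z)) \<le> \<bar>\<kappa>\<bar> * \<bar>Re (w * cnj z)\<bar>"
    using abs_ge_minus_self[of "\<kappa> * Re (w * cnj z)"] by (simp only: abs_mult)
  ultimately have "- (2 * \<kappa> * Re (w * cnj z)) \<le> 2 * ((sqrt p * sqrt q) * (cmod w * cmod z))"
    by linarith
  also have "\<dots> = 2 * (sqrt p * cmod z) * (sqrt q * cmod w)" by simp
  also have "\<dots> \<le> (sqrt p * cmod z)\<^sup>2 + (sqrt q * cmod w)\<^sup>2"
    using zero_le_power2[of "sqrt p * cmod z - sqrt q * cmod w"] by (simp add: power2_diff)
  also have "\<dots> = p * (cmod z)\<^sup>2 + q * (cmod w)\<^sup>2"
    using assms by (simp add: power_mult_distrib)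
  finally show ?thesis by simp
qed

text \<open>
  Away from the origin the weights are those of a tensor product; the condition on \<open>a\<close>
  and \<open>b\<close> makes the two paths from \<open>(0, 0)\<close> to \<open>(1, 1)\<close> agree.
\<close>

locale corner_perturbation =
  fixes \<xi> \<eta> :: "nat \<Rightarrow> real" and a b K :: real
  assumes \<xi>_pos: "\<And>k. 0 < \<xi> k" and \<eta>_pos: "\<And>k. 0 < \<eta> k"
    and \<xi>_mono: "strict_mono \<xi>" and \<eta>_mono: "strict_mono \<eta>"
    and \<xi>_bound: "\<And>k. \<xi> k \<le> K" and \<eta>_bound: "\<And>k. \<eta> k \<le> K"
    and ab: "0 < a" "a < 1" "0 < b" "b < 1" "a * \<eta> 0 = b * \<xi> 0"
begin

definition \<alpha> :: "nat \<times> nat \<Rightarrow> real" where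
  "\<alpha> = (\<lambda>(k1, k2). if k1 \<ge> 1 \<or> k2 \<ge> 1 then \<xi> k1 else a)"

definition \<beta> :: "nat \<times> nat \<Rightarrow> real" where
  "\<beta> = (\<lambda>(k1, k2). if k1 \<ge> 1 \<or> k2 \<ge> 1 then \<eta> k2 else b)"

sublocale bounded_weights2 \<alpha> \<beta> "max K 1"
  using \<xi>_pos \<eta>_pos \<xi>_bound \<eta>_bound ab
  by unfold_locales (auto simp: \<alpha>_def \<beta>_def le_max_iff_disj abs_of_pos split: prod.split)

lemma weights: "\<alpha> (0, 0) = a" "\<alpha> (Suc m, n) = \<xi> (Suc m)" "\<alpha> (m, Suc n) = \<xi> m"
  "\<beta> (0, 0) = b" "\<beta> (m, Suc n) = \<eta> (Suc n)" "\<beta> (Suc m, n) = \<eta> n"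
  by (simp_all add: \<alpha>_def \<beta>_def)

lemma T_commute: "T1 \<circ> T2 = T2 \<circ> T1"
proof (rule commute)
  show "\<alpha> (m, Suc n) * \<beta> (m, n) = \<beta> (Suc m, n) * \<alpha> (m, n)" for m n
    using ab by (cases m; cases n) (simp_all add: weights mult.commute)
qed

text \<open>
  The commutators are computed entry by entry.  The diagonal ones are nonnegative because the weights
  increase along rows and columns; the mixed ones vanish wherever the weights factor, which leaves the
  entry \<open>\<kappa>\<close> between \<open>(1, 0)\<close> and \<open>(0, 1)\<close>.
\<close>

lemma hyponormal:
  assumes pq: "a \<le> \<xi> 1" "b \<le> \<eta> 1"
    and det: "(\<xi> 0 * \<eta> 0 - a * b)\<^sup>2 \<le> ((\<xi> 1)\<^sup>2 - a\<^sup>2) * ((\<eta> 1)\<^sup>2 - b\<^sup>2)"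
  shows "hyponormal_pair T1 T2"
proof -
  define d1 where "d1 = (\<lambda>(m, n). (\<alpha> (m, n))\<^sup>2 - (case m of 0 \<Rightarrow> 0 | Suc m' \<Rightarrow> (\<alpha> (m', n))\<^sup>2))"
  define d2 where "d2 = (\<lambda>(m, n). (\<beta> (m, n))\<^sup>2 - (case n of 0 \<Rightarrow> 0 | Suc n' \<Rightarrow> (\<beta> (m, n'))\<^sup>2))"
  define \<kappa> where "\<kappa> = \<xi> 0 * \<eta> 0 - a * b"
  have le: "(\<xi> n)\<^sup>2 \<le> (\<xi> (Suc n))\<^sup>2" "(\<eta> n)\<^sup>2 \<le> (\<eta> (Suc n))\<^sup>2" for n
    using \<xi>_mono \<eta>_mono \<xi>_pos[of n] \<eta>_pos[of n]
    by (auto intro!: power_mono simp: strict_mono_def less_imp_le)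
  have sq: "a\<^sup>2 \<le> (\<xi> (Suc 0))\<^sup>2" "b\<^sup>2 \<le> (\<eta> (Suc 0))\<^sup>2"
    using pq ab by (auto intro!: power_mono)
  have d1: "0 \<le> d1 k" for k
  proof -
    obtain m n where k: "k = (m, n)" by (cases k)
    consider "m = 0" | "m = 1" "n = 0" | m' where "m = Suc (Suc m')" | m' n' where "m = Suc m'" "n = Suc n'"
      by (metis One_nat_def not0_implies_Suc)
    then show ?thesis by cases (auto simp: k d1_def weights sq le)
  qed
  have d2: "0 \<le> d2 k" for k
  proof -
    obtain m n where k: "k = (m, n)" by (cases k)
    consider "n = 0" | "n = 1" "m = 0" | n' where "n = Suc (Suc n')" | m' n' where "m = Suc m'" "n = Suc n'"
      by (metis One_nat_def not0_implies_Suc)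
    then show ?thesis by cases (auto simp: k d2_def weights sq le)
  qed
  have A: "Rep_ell2 (commutator T1' T1 x) k = complex_of_real (d1 k) * Rep_ell2 x k" for x k
    by (cases k; cases "fst k")
      (auto simp: commutator_def minus_ell2.rep_eq Rep_T1 Rep_T1' d1_def power2_eq_square algebra_simps)
  have D: "Rep_ell2 (commutator T2' T2 x) k = complex_of_real (d2 k) * Rep_ell2 x k" for x k
    by (cases k; cases "snd k")
      (auto simp: commutator_def minus_ell2.rep_eq Rep_T2 Rep_T2' d2_def power2_eq_square algebra_simps)
  have B: "Rep_ell2 (commutator T2' T1 y) k =
      (if k = (1, 0) then complex_of_real \<kappa> * Rep_ell2 y (0, 1) else 0)" for y k
  proof -
    obtain m n where k: "k = (m, n)" by (cases k)
    consider "m = 0" | "m = 1" "n = 0" | m' where "m = Suc (Suc m')" | m' n' where "m = Suc m'" "n = Suc n'"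
      by (metis One_nat_def not0_implies_Suc)
    then show ?thesis
      by cases (auto simp: k commutator_def minus_ell2.rep_eq Rep_T1 Rep_T2' weights \<kappa>_def algebra_simps)
  qed
  have Cc: "Rep_ell2 (commutator T1' T2 y) k =
      (if k = (0, 1) then complex_of_real \<kappa> * Rep_ell2 y (1, 0) else 0)" for y k
  proof -
    obtain m n where k: "k = (m, n)" by (cases k)
    consider "n = 0" | "n = 1" "m = 0" | n' where "n = Suc (Suc n')" | m' n' where "m = Suc m'" "n = Suc n'"
      by (metis One_nat_def not0_implies_Suc)
    then show ?thesis
      by cases (auto simp: k commutator_def minus_ell2.rep_eq Rep_T2 Rep_T1' weights \<kappa>_def algebra_simps)
  qed
  have "positive_op (op_matrix (commutator T1' T1) (commutator T2' T1)
      (commutator T1' T2) (commutator T2' T2))"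
    unfolding positive_op_def
  proof (intro allI)
    fix p :: "(nat \<times> nat) ell2 \<times> (nat \<times> nat) ell2"
    obtain x y where p: "p = (x, y)" by (cases p)
    define z where "z = Rep_ell2 x (1, 0)"
    define w where "w = Rep_ell2 y (0, 1)"
    let ?A = "cinner (commutator T1' T1 x) x" and ?D = "cinner (commutator T2' T2 y) y"
    let ?c = "cinner (op_matrix (commutator T1' T1) (commutator T2' T1)
      (commutator T1' T2) (commutator T2' T2) p) p"
    have c: "?c = ?A + complex_of_real \<kappa> * w * cnj z + (complex_of_real \<kappa> * z * cnj w + ?D)"
      by (simp add: p op_matrix_def cinner_prod_def cinner_add_left z_def w_def
          cinner_single[OF B] cinner_single[OF Cc])
    note dA = cinner_diagonal[OF A d1] and dD = cinner_diagonal[OF D d2]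
    have "Im ?c = 0" by (simp add: c dA dD algebra_simps)
    moreover have "0 \<le> Re ?c"
    proof -
      have "0 \<le> d1 (1, 0) * (cmod z)\<^sup>2 + d2 (0, 1) * (cmod w)\<^sup>2 + 2 * \<kappa> * Re (w * cnj z)"
        by (rule two_by_two_form_nonneg[OF d1 d2])
          (use det in \<open>simp add: d1_def d2_def weights \<kappa>_def\<close>)
      also have "\<dots> \<le> Re ?A + Re ?D + 2 * \<kappa> * Re (w * cnj z)"
        using dA(2)[of "(1, 0)" x] dD(2)[of "(0, 1)" y] by (simp add: z_def w_def)
      also have "\<dots> = Re ?c" by (simp add: c algebra_simps)
      finally show ?thesis .
    qed
    ultimately show "?c \<in> \<real> \<and> 0 \<le> Re ?c" by (simp add: complex_is_Real_iff)
  qed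
  then show ?thesis by (simp add: hyponormal_pair_def bounded_clinear_T cadjoint_T)
qed

lemma T1_power_basis:
  assumes "1 \<le> m \<or> 1 \<le> n"
  shows "(T1 ^^ k) (ell2_basis (m, n)) = (\<Prod>i<k. \<xi> (m + i)) *\<^sub>R ell2_basis (m + k, n)"
proof (induction k)
  case (Suc k)
  interpret T1: bounded_linear T1 using bounded_clinear_T by (simp add: bounded_clinear_def)
  have "\<alpha> (m + k, n) = \<xi> (m + k)" using assms by (auto simp: \<alpha>_def)
  then show ?case using Suc by (simp add: T1.scaleR T_basis)
qed simp

text \<open>
  Apply \<open>commuting_normal_extension_bound\<close> to the images of the basis vectors at \<open>(0, 0)\<close>, \<open>(0, 1)\<close>
  and \<open>(0, 2)\<close>.  Along the first coordinate the rows 1 and 2 have the same weights, and row 0 differs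
  only in its first weight, whence the factor \<open>a\<^sup>2 / (\<xi> 0)\<^sup>2\<close> between the moments.
\<close>

lemma subnormal_bound:
  assumes "subnormal_pair TYPE('k::complex_hilbert_space) T1 T2"
  shows "a\<^sup>2 * ((\<xi> 0)\<^sup>2 * (\<eta> 1)\<^sup>2 + (\<xi> 1)\<^sup>2 * (\<eta> 0)\<^sup>2 - (\<xi> 0)\<^sup>2 * (\<eta> 0)\<^sup>2)
    \<le> (\<xi> 0)\<^sup>2 * (\<xi> 1)\<^sup>2 * (\<eta> 1)\<^sup>2"
proof -
  obtain N1 N2 :: "'k \<Rightarrow> 'k" and J :: "(nat \<times> nat) ell2 \<Rightarrow> 'k"
    where norm: "normal_pair N1 N2" and J: "cisometry J"
      and N1: "\<And>x. N1 (J x) = J (T1 x)" and N2: "\<And>x. N2 (J x) = J (T2 x)"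
    using assms by (auto simp: subnormal_pair_def)
  interpret J: bounded_linear J using J by (simp add: cisometry_def bounded_clinear_def)
  interpret T1: bounded_linear T1 using bounded_clinear_T by (simp add: bounded_clinear_def)
  have normJ: "norm (J x) = norm x" for x
    using J by (metis cisometry_def Re_cinner norm_eq_sqrt_inner)
  have N1_power: "(N1 ^^ k) (J x) = J ((T1 ^^ k) x)" for k x
    by (induction k) (simp_all add: N1)
  let ?e = "\<lambda>m n. J (ell2_basis (m, n))"
  have row: "norm ((N1 ^^ k) (?e m n)) = (\<Prod>i<k. \<xi> (m + i))" if "1 \<le> m \<or> 1 \<le> n" for k m n
    unfolding N1_power normJ T1_power_basis[OF that]
    using \<xi>_pos by (simp add: norm_ell2_basis abs_of_pos prod_pos)
  define c where "c = a\<^sup>2 / (\<xi> 0)\<^sup>2"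
  have bc: "b\<^sup>2 = c * (\<eta> 0)\<^sup>2"
    using ab \<xi>_pos[of 0] by (simp add: c_def field_simps flip: power_mult_distrib)
  have "c * (1 - (1 - (\<xi> 0)\<^sup>2 / (\<xi> 1)\<^sup>2)) + b\<^sup>2 / (\<eta> 1)\<^sup>2 * (1 - (\<xi> 0)\<^sup>2 / (\<xi> 1)\<^sup>2) \<le> 1"
  proof (rule commuting_normal_extension_bound)
    show "hilbert_normal N1 (cadjoint N1)" "hilbert_normal N2 (cadjoint N2)"
      using norm by (auto simp: normal_pair_def intro: hilbert_normal_of_normal_op)
    show "N2 (N1 x) = N1 (N2 x)" for x
      using norm unfolding normal_pair_def by (metis comp_apply)
    show "norm (?e 0 0) = 1" "norm (?e 0 1) = 1" "norm (?e 0 2) = 1"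
      by (simp_all add: normJ norm_ell2_basis)
    show "N2 (?e 0 0) = b *\<^sub>R ?e 0 1" "N2 (?e 0 1) = \<eta> 1 *\<^sub>R ?e 0 2"
      using weights(5)[of 0 0]
      by (simp_all add: N2 T_basis weights J.scaleR numeral_2_eq_2)
    show "(norm ((N1 ^^ k) (?e 0 0)))\<^sup>2 = c * (norm ((N1 ^^ k) (?e 0 1)))\<^sup>2" if "1 \<le> k" for k
    proof -
      have k: "k = Suc (k - 1)" using that by simp
      define n where "n = k - 1"
      have k: "k = Suc n" using k by (simp add: n_def)
      have scale: "(T1 ^^ n) (r *\<^sub>R x) = r *\<^sub>R (T1 ^^ n) x" for r x
        by (induction n) (simp_all add: T1.scaleR)
      have "(N1 ^^ k) (?e 0 0) = a *\<^sub>R (N1 ^^ n) (?e 1 0)"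
      proof -
        have "(N1 ^^ k) (?e 0 0) = (N1 ^^ n) (N1 (?e 0 0))" by (simp add: k funpow_swap1)
        also have "\<dots> = J ((T1 ^^ n) (a *\<^sub>R ell2_basis (1, 0)))"
          by (simp add: N1 N1_power T_basis weights)
        finally show ?thesis by (simp add: scale J.scaleR N1_power)
      qed
      then have "(norm ((N1 ^^ k) (?e 0 0)))\<^sup>2 = a\<^sup>2 * (\<Prod>i<n. \<xi> (Suc i))\<^sup>2"
        using row[of 1 0 n] by (simp add: power_mult_distrib)
      moreover have "norm ((N1 ^^ k) (?e 0 1)) = \<xi> 0 * (\<Prod>i<n. \<xi> (Suc i))"
        using row[of 0 1 k] by (simp add: k prod.lessThan_Suc_shift del: prod.lessThan_Suc)
      ultimately show ?thesis using \<xi>_pos[of 0] by (simp add: c_def power_mult_distrib)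
    qed
    show "(norm ((N1 ^^ k) (?e 0 2)))\<^sup>2 = (norm ((N1 ^^ k) (?e 0 1)))\<^sup>2" for k
      by (simp add: row)
    show "(norm (N1 (?e 0 1)))\<^sup>2 = (\<xi> 0)\<^sup>2" using row[of 0 1 1] by simp
    show "(norm (N1 (N1 (?e 0 1))))\<^sup>2 = (\<xi> 0)\<^sup>2 * (\<xi> 1)\<^sup>2"
      using row[of 0 1 2] by (simp add: numeral_2_eq_2 power_mult_distrib)
    have "(\<eta> 0)\<^sup>2 \<le> (\<eta> 1)\<^sup>2"
      using \<eta>_mono \<eta>_pos[of 0] by (intro power_mono) (auto simp: strict_mono_def less_imp_le)
    then have "c * (\<eta> 0)\<^sup>2 \<le> c * (\<eta> 1)\<^sup>2" by (intro mult_left_mono) (auto simp: c_def)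
    then show "b\<^sup>2 / (\<eta> 1)\<^sup>2 \<le> c" using \<eta>_pos[of 1] by (simp add: bc divide_le_eq)
  qed (use ab \<xi>_pos \<eta>_pos in \<open>auto simp: c_def less_imp_neq[symmetric]\<close>)
  moreover have "c * (1 - (1 - (\<xi> 0)\<^sup>2 / (\<xi> 1)\<^sup>2)) + b\<^sup>2 / (\<eta> 1)\<^sup>2 * (1 - (\<xi> 0)\<^sup>2 / (\<xi> 1)\<^sup>2) =
      a\<^sup>2 * ((\<xi> 0)\<^sup>2 * (\<eta> 1)\<^sup>2 + (\<xi> 1)\<^sup>2 * (\<eta> 0)\<^sup>2 - (\<xi> 0)\<^sup>2 * (\<eta> 0)\<^sup>2) /
      ((\<xi> 0)\<^sup>2 * (\<xi> 1)\<^sup>2 * (\<eta> 1)\<^sup>2)"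
    unfolding bc using \<xi>_pos[of 0] \<xi>_pos[of 1] \<eta>_pos[of 1] by (simp add: c_def field_simps)
  moreover have "0 < (\<xi> 0)\<^sup>2 * (\<xi> 1)\<^sup>2 * (\<eta> 1)\<^sup>2"
    using \<xi>_pos[of 0] \<xi>_pos[of 1] \<eta>_pos[of 1] by simp
  ultimately show ?thesis by (simp add: divide_le_eq)
qed

end

section \<open>Thresholds\<close>

text \<open>
  With \<open>A = a\<^sup>2\<close> and \<open>b\<^sup>2 = A y / x\<close>, the determinant condition of the two by two matrix becomes linear
  in \<open>A\<close> since the quadratic terms cancel; it says \<open>a \<le> h\<close>.  The two conditions on the diagonal
  follow from it because \<open>(X - x)\<^sup>2\<close> and \<open>(Y - y)\<^sup>2\<close> are nonnegative.
\<close>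

lemma hyponormality_threshold:
  fixes x X y Y A :: real
  assumes xy: "0 < x" "x < X" "0 < y" "y < Y"
    and A: "A * (x * Y + X * y - 2 * x * y) \<le> x * (X * Y - x * y)"
  shows "A \<le> X" "A * y / x \<le> Y" "y / x * (x - A)\<^sup>2 \<le> (X - A) * (Y - A * y / x)"
proof -
  have den: "0 < x * Y + X * y - 2 * x * y"
    using mult_strict_left_mono[OF xy(4) xy(1)] mult_strict_right_mono[OF xy(2) xy(3)] by simp
  have "0 \<le> y * (X - x)\<^sup>2" using xy by simp
  then have "x * (X * Y - x * y) \<le> X * (x * Y + X * y - 2 * x * y)"
    by (simp add: power2_eq_square algebra_simps)
  with A have "A * (x * Y + X * y - 2 * x * y) \<le> X * (x * Y + X * y - 2 * x * y)" by linarith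
  then show "A \<le> X" using den by simp
  have "0 \<le> x * (x * (Y - y)\<^sup>2)" using xy by simp
  then have "y * (x * (X * Y - x * y)) \<le> x * Y * (x * Y + X * y - 2 * x * y)"
    by (simp add: power2_eq_square algebra_simps)
  moreover have "y * (A * (x * Y + X * y - 2 * x * y)) \<le> y * (x * (X * Y - x * y))"
    using A xy by (intro mult_left_mono) auto
  ultimately have "(A * y) * (x * Y + X * y - 2 * x * y) \<le> (x * Y) * (x * Y + X * y - 2 * x * y)"
    by (simp add: mult_ac)
  then have "A * y \<le> x * Y" using den by simp
  then show "A * y / x \<le> Y" using xy by (simp add: divide_le_eq mult.commute)
  have "y * (x - A)\<^sup>2 \<le> (X - A) * (x * Y - A * y)"
    using A by (simp add: power2_eq_square algebra_simps)
  then have "y * (x - A)\<^sup>2 / x \<le> (X - A) * (x * Y - A * y) / x"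
    using xy by (intro divide_right_mono) auto
  also have "(X - A) * (x * Y - A * y) / x = (X - A) * (Y - A * y / x)"
    using xy by (simp add: field_simps)
  finally show "y / x * (x - A)\<^sup>2 \<le> (X - A) * (Y - A * y / x)" by simp
qed

text \<open>
  The conclusion is a quadratic inequality in \<open>y\<close> with leading coefficient \<open>x\<close>; the bound on \<open>y\<close> is
  its smaller root, and \<open>d\<close> is its discriminant, nonnegative because \<open>E \<le> Y\<close>.
\<close>

lemma below_smaller_root:
  fixes x X y Y E :: real
  assumes "0 < x" "x < X" "0 \<le> E" "E \<le> Y"
    and y: "y \<le> (X * (Y - E) + 2 * x * E
      - sqrt ((Y - E) * (X\<^sup>2 * (Y - E) + 4 * x * E * (X - x)))) / (2 * x)"
  shows "y * (X * Y - x * y) \<le> E * (x * Y + X * y - 2 * x * y)"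
proof -
  define m where "m = X * (Y - E) + 2 * x * E"
  define d where "d = (Y - E) * (X\<^sup>2 * (Y - E) + 4 * x * E * (X - x))"
  have d: "0 \<le> d" unfolding d_def using assms by (intro mult_nonneg_nonneg add_nonneg_nonneg) auto
  have "sqrt d \<le> m - 2 * x * y"
    using y assms(1) by (simp add: m_def d_def field_simps)
  then have "(sqrt d)\<^sup>2 \<le> (m - 2 * x * y)\<^sup>2" using d by (intro power_mono) auto
  then have "d \<le> (m - 2 * x * y)\<^sup>2" using d by simp
  moreover have "(m - 2 * x * y)\<^sup>2 - d =
      4 * x * (E * (x * Y + X * y - 2 * x * y) - y * (X * Y - x * y))"
    by (simp add: m_def d_def power2_eq_square algebra_simps)
  ultimately have "0 \<le> 4 * x * (E * (x * Y + X * y - 2 * x * y) - y * (X * Y - x * y))" by simp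
  then show ?thesis using assms(1) by (simp add: zero_le_mult_iff)
qed

theorem theorem2p3:
  fixes \<xi> \<eta> :: "nat \<Rightarrow> real"
    and a b \<eta>\<^sub>e h s s2 u v :: real
    and \<nu> \<omega> \<nu>\<^sub>M \<omega>\<^sub>M :: "real measure"
    and \<alpha> \<beta> :: "nat \<times> nat \<Rightarrow> real"
    and T1 T2 :: "(nat \<times> nat) ell2 \<Rightarrow> (nat \<times> nat) ell2"
  assumes "bounded (range \<xi>)" "strict_mono \<xi>" "\<And>k. 0 < \<xi> k"
    and "bounded (range \<eta>)" "strict_mono \<eta>" "\<And>k. 0 < \<eta> k"
    and "subnormal_op TYPE('k1::complex_hilbert_space) (weighted_shift \<xi>)"
    and "subnormal_op TYPE('k2::complex_hilbert_space) (weighted_shift \<eta>)"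
    and "Berger_measure \<xi> \<nu>" "Berger_measure \<eta> \<omega>"
    and "0 < a" "a < 1" "0 < b" "b < 1"
    and "a * \<eta> 0 = b * \<xi> 0"
    and "\<alpha> = (\<lambda>(k1, k2). if k1 \<ge> 1 \<or> k2 \<ge> 1 then \<xi> k1 else a)"
    and "\<beta> = (\<lambda>(k1, k2). if k1 \<ge> 1 \<or> k2 \<ge> 1 then \<eta> k2 else b)"
    and "T1 = weighted_shift2_fst \<alpha>" "T2 = weighted_shift2_snd \<beta>"
    and "Berger_measure (\<lambda>k. \<xi> (k + 1)) \<nu>\<^sub>M" "Berger_measure (\<lambda>k. \<eta> (k + 1)) \<omega>\<^sub>M"
    and "\<eta>\<^sub>e = extremal \<omega>\<^sub>M"
    and "h = \<xi> 0 * sqrt (((\<xi> 1)\<^sup>2 * (\<eta> 1)\<^sup>2 - (\<xi> 0)\<^sup>2 * (\<eta> 0)\<^sup>2) /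
               ((\<xi> 0)\<^sup>2 * (\<eta> 1)\<^sup>2 + (\<xi> 1)\<^sup>2 * (\<eta> 0)\<^sup>2 - 2 * (\<xi> 0)\<^sup>2 * (\<eta> 0)\<^sup>2))"
    and "s = sqrt ((\<xi> 0)\<^sup>2 * (\<xi> 1)\<^sup>2 * (\<eta> 1)\<^sup>2 /
               ((\<xi> 1)\<^sup>2 * (\<eta> 0)\<^sup>2 + (\<xi> 0)\<^sup>2 * (\<eta> 1)\<^sup>2 - (\<xi> 0)\<^sup>2 * (\<eta> 0)\<^sup>2))"
    and "s2 = \<xi> 0 / \<eta> 0 * \<eta>\<^sub>e"
    and "u = (\<xi> 0)\<^sup>2 * \<eta>\<^sub>e\<^sup>2 * (\<eta> 1)\<^sup>2 /
               ((\<xi> 1)\<^sup>2 * ((\<eta> 1)\<^sup>2 - \<eta>\<^sub>e\<^sup>2) + (\<xi> 0)\<^sup>2 * \<eta>\<^sub>e\<^sup>2)"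
    and "v = ((\<xi> 1)\<^sup>2 * ((\<eta> 1)\<^sup>2 - \<eta>\<^sub>e\<^sup>2) + 2 * (\<xi> 0)\<^sup>2 * \<eta>\<^sub>e\<^sup>2
               - sqrt (((\<eta> 1)\<^sup>2 - \<eta>\<^sub>e\<^sup>2) *
                   ((\<xi> 1) ^ 4 * ((\<eta> 1)\<^sup>2 - \<eta>\<^sub>e\<^sup>2)
                     + 4 * (\<xi> 0)\<^sup>2 * \<eta>\<^sub>e\<^sup>2 * ((\<xi> 1)\<^sup>2 - (\<xi> 0)\<^sup>2))))
             / (2 * (\<xi> 0)\<^sup>2)"
    and "s2 = extremal \<nu>\<^sub>M"
    and "\<eta> 0 \<le> min u v"
    and "s < a" "a \<le> h"
  shows "T1 \<circ> T2 = T2 \<circ> T1 \<and>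
    subnormal_op TYPE(nat ell2) T1 \<and>
    subnormal_op TYPE(nat ell2) T2 \<and>
    hyponormal_pair T1 T2 \<and>
    \<not> subnormal_pair TYPE('k::complex_hilbert_space) T1 T2"
proof -
  note bdd = assms(1,4) and mono = assms(2,5) and pos = assms(3,6)
  note a01 = assms(11-14) and ab = assms(15)
  let ?x = "(\<xi> 0)\<^sup>2" and ?X = "(\<xi> 1)\<^sup>2" and ?y = "(\<eta> 0)\<^sup>2" and ?Y = "(\<eta> 1)\<^sup>2"
  let ?E = "\<eta>\<^sub>e\<^sup>2" and ?den = "(\<xi> 0)\<^sup>2 * (\<eta> 1)\<^sup>2 + (\<xi> 1)\<^sup>2 * (\<eta> 0)\<^sup>2 - 2 * (\<xi> 0)\<^sup>2 * (\<eta> 0)\<^sup>2"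
  have \<alpha>: "\<alpha> = (\<lambda>(k1, k2). if k1 \<ge> 1 \<or> k2 \<ge> 1 then \<xi> k1 else a)"
    and \<beta>: "\<beta> = (\<lambda>(k1, k2). if k1 \<ge> 1 \<or> k2 \<ge> 1 then \<eta> k2 else b)" by fact+
  have T: "T1 = weighted_shift2_fst \<alpha>" "T2 = weighted_shift2_snd \<beta>" by fact+
  have \<nu>M: "Berger_measure (\<lambda>k. \<xi> (k + 1)) \<nu>\<^sub>M" and \<omega>M: "Berger_measure (\<lambda>k. \<eta> (k + 1)) \<omega>\<^sub>M" by fact+
  have sa: "s < a" and ah: "a \<le> h" and s2: "\<xi> 0 / \<eta> 0 * \<eta>\<^sub>e = extremal \<nu>\<^sub>M"
    and \<eta>e: "\<eta>\<^sub>e = extremal \<omega>\<^sub>M" and \<eta>v: "\<eta> 0 \<le> v"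
    using assms by auto
  have "\<xi> 0 < \<xi> 1" "\<eta> 0 < \<eta> 1" using mono by (auto simp: strict_mono_def)
  then have xy: "0 < ?x" "?x < ?X" "0 < ?y" "?y < ?Y"
    using pos(1)[of 0] pos(2)[of 0] by (auto intro!: power_strict_mono)
  have xX: "?x * ?y < ?x * ?Y" "?x * ?y < ?X * ?y" using xy by simp_all
  have den: "0 < ?den" using xX by simp
  define sden where "sden = ?X * ?y + ?x * ?Y - ?x * ?y"
  have sden: "0 < sden" unfolding sden_def using xX xy by (simp add: add_pos_pos less_diff_eq add_strict_increasing2)
  have s_sq: "?x * ?X * ?Y < a\<^sup>2 * sden"
  proof -
    have "sqrt (?x * ?X * ?Y / sden) < a" using sa assms(24) by (simp add: sden_def)
    then have "?x * ?X * ?Y / sden < a\<^sup>2"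
      using a01(1) by (metis real_less_lsqrt real_sqrt_less_iff real_sqrt_unique less_imp_le)
    then show ?thesis using sden by (simp add: divide_less_eq)
  qed
  \<comment> \<open>\<open>s\<close> exceeds \<open>\<xi> 0\<close> because \<open>(X - x) (Y - y) > 0\<close>.\<close>
  have xa: "\<xi> 0 < a"
  proof -
    have "0 < (?X - ?x) * (?Y - ?y)" using xy by simp
    then have "?x * sden < ?x * (?X * ?Y)"
      using xy by (intro mult_strict_left_mono) (simp_all add: sden_def algebra_simps)
    with s_sq have "?x * sden < a\<^sup>2 * sden" by (simp add: mult_ac)
    then have "?x < a\<^sup>2" using sden by simp
    then show ?thesis using a01(1) by (meson less_imp_le power_less_imp_less_base)
  qed
  have "\<eta> 0 * \<xi> 0 < b * \<xi> 0" using mult_strict_right_mono[OF xa pos(2)[of 0]] ab by (simp add: mult.commute)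
  then have "\<eta> 0 < 1" using pos(1)[of 0] a01(4) by simp
  then have "?y \<le> \<eta> 0" using pos(2)[of 0] by (simp add: power2_eq_square mult_left_le)
  with \<eta>v have yv: "?y \<le> v" by simp
  have h_sq: "a\<^sup>2 * ?den \<le> ?x * (?X * ?Y - ?x * ?y)"
  proof -
    have "0 \<le> ?X * ?Y - ?x * ?y" using xy mult_mono[of ?x ?X ?y ?Y] by simp
    then have "h\<^sup>2 = ?x * ((?X * ?Y - ?x * ?y) / ?den)"
      using den assms(23) by (simp add: power_mult_distrib)
    moreover have "a\<^sup>2 \<le> h\<^sup>2" using ah a01(1) by (intro power_mono) auto
    ultimately have "a\<^sup>2 \<le> ?x * (?X * ?Y - ?x * ?y) / ?den" by simp
    then show ?thesis using den by (simp add: le_divide_eq)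
  qed
  have E: "?E \<le> ?Y"
    using extremal_square_le_mean[OF \<omega>M] pos(2) by (simp add: \<eta>e)
  \<comment> \<open>Dividing, this is \<open>h\<^sup>2 y \<le> x E\<close>.\<close>
  have root: "?y * (?X * ?Y - ?x * ?y) \<le> ?E * (?x * ?Y + ?X * ?y - 2 * ?x * ?y)"
  proof (rule below_smaller_root[OF xy(1,2) _ E])
    have "\<xi> 1 ^ 4 = ?X\<^sup>2" by simp
    then show "?y \<le> (?X * (?Y - ?E) + 2 * ?x * ?E
        - sqrt ((?Y - ?E) * (?X\<^sup>2 * (?Y - ?E) + 4 * ?x * ?E * (?X - ?x)))) / (2 * ?x)"
      using yv assms(27) by simp
  qed simp
  have "a\<^sup>2 * ?y * ?den \<le> ?x * ?E * ?den"
  proof -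
    have "?y * (a\<^sup>2 * ?den) \<le> ?y * (?x * (?X * ?Y - ?x * ?y))"
      using h_sq by (rule mult_left_mono) simp
    also have "\<dots> = ?x * (?y * (?X * ?Y - ?x * ?y))" by simp
    also have "\<dots> \<le> ?x * (?E * ?den)" using root by (rule mult_left_mono) simp
    finally show ?thesis by (simp add: mult_ac)
  qed
  then have "(a * \<eta> 0)\<^sup>2 \<le> (\<xi> 0 * \<eta>\<^sub>e)\<^sup>2" using den by (simp add: power_mult_distrib)
  moreover have "0 \<le> \<eta>\<^sub>e" by (simp add: \<eta>e extremal_def)
  ultimately have a\<eta>: "a * \<eta> 0 \<le> \<xi> 0 * \<eta>\<^sub>e"
    using pos(1)[of 0] by (meson less_imp_le mult_nonneg_nonneg power2_le_imp_le)
  then have a_le: "a \<le> extremal \<nu>\<^sub>M"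
    using pos(2)[of 0] by (simp add: s2[symmetric] le_divide_eq)
  have b_le: "b \<le> extremal \<omega>\<^sub>M"
    using a\<eta> pos(1)[of 0] unfolding ab \<eta>e by (simp add: mult.commute)
  obtain M M' where M: "\<And>k. \<bar>\<xi> k\<bar> \<le> M" "\<And>k. \<bar>\<eta> k\<bar> \<le> M'"
    using bdd by (auto simp: bounded_iff)
  interpret W: corner_perturbation \<xi> \<eta> a b "max M M'"
  proof
    show "\<xi> k \<le> max M M'" "\<eta> k \<le> max M M'" for k
      using M(1)[of k] M(2)[of k] by auto
  qed (use pos mono a01 ab in auto)
  have W: "W.\<alpha> = \<alpha>" "W.\<beta> = \<beta>" unfolding W.\<alpha>_def W.\<beta>_def \<alpha> \<beta> by (rule refl)+
  have WT: "W.T1 = T1" "W.T2 = T2" 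
    unfolding W.T1_def W.T2_def unfolding W T by (rule refl)+
  have "subnormal_op TYPE(nat ell2) T2"
    unfolding T \<beta> using subnormal_perturbed_rows[OF bdd(2) pos(2) assms(10) \<omega>M a01(3) b_le] .
  moreover have "subnormal_op TYPE(nat ell2) T1"
  proof -
    define \<alpha>' where "\<alpha>' = (\<lambda>(k1::nat, k2). if k1 \<ge> 1 \<or> k2 \<ge> 1 then \<xi> k2 else a)"
    have sw: "\<alpha>' (m, n) = \<alpha> (n, m)" for m n by (auto simp: \<alpha>'_def \<alpha>)
    interpret S: bounded_weights2 \<alpha> \<alpha>' "max (max M M') 1"
      using W.\<alpha>_bound by unfold_locales (auto simp: W sw)
    have "subnormal_op TYPE(nat ell2) S.T2"
      unfolding S.T2_def unfolding \<alpha>'_def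
      by (rule subnormal_perturbed_rows[OF bdd(1) pos(1) assms(9) \<nu>M a01(1) a_le])
    then have "subnormal_op TYPE(nat ell2) S.T1"
      by (rule subnormal_op_restrict[OF _ cisometry_embed[OF inj_swap] S.bounded_clinear_T(1)])
        (rule S.swap_intertwines[OF sw])
    then show ?thesis by (simp add: S.T1_def T)
  qed
  moreover have "hyponormal_pair T1 T2"
    unfolding WT[symmetric]
  proof (rule W.hyponormal)
    have b: "b = a * \<eta> 0 / \<xi> 0" using ab pos(1)[of 0] by (simp add: field_simps)
    have bb: "b\<^sup>2 = a\<^sup>2 * ?y / ?x" by (simp add: b power_mult_distrib power_divide)
    note thr = hyponormality_threshold[OF xy, of "a\<^sup>2"]
    have h': "a\<^sup>2 * (?x * ?Y + ?X * ?y - 2 * ?x * ?y) \<le> ?x * (?X * ?Y - ?x * ?y)" by (rule h_sq)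
    show "a \<le> \<xi> 1" using thr(1)[OF h'] pos(1)[of 1] by (meson less_imp_le power2_le_imp_le)
    show "b \<le> \<eta> 1"
      using thr(2)[OF h'] pos(2)[of 1] unfolding bb[symmetric] by (meson less_imp_le power2_le_imp_le)
    have "\<xi> 0 * \<eta> 0 - a * b = \<eta> 0 / \<xi> 0 * (?x - a\<^sup>2)"
      using pos(1)[of 0] by (simp add: b power2_eq_square field_simps)
    then have "(\<xi> 0 * \<eta> 0 - a * b)\<^sup>2 = ?y / ?x * (?x - a\<^sup>2)\<^sup>2"
      by (simp add: power_mult_distrib power_divide)
    then show "(\<xi> 0 * \<eta> 0 - a * b)\<^sup>2 \<le> (?X - a\<^sup>2) * (?Y - b\<^sup>2)"
      using thr(3)[OF h'] by (simp add: bb)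
  qed
  moreover have "\<not> subnormal_pair TYPE('k) T1 T2"
  proof
    assume "subnormal_pair TYPE('k) T1 T2"
    then have "a\<^sup>2 * sden \<le> ?x * ?X * ?Y"
      using W.subnormal_bound unfolding WT sden_def by (simp add: add.commute)
    with s_sq show False by simp
  qed
  moreover have "T1 \<circ> T2 = T2 \<circ> T1" using W.T_commute by (simp add: WT)
  ultimately show ?thesis by blast
qed

end
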